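(* (1) Let $G$ be a finitely generated non-abelian group. Then $G$ is natural if and only if $G$ is not generalized dicyclic. (2) Let $G$ be a finitely generated abelian group. Then $G$ is natural if and only if $G$ is finite of odd order or $G \cong C_2^r$ for some integer $r \ge 0$.
   Context: A group $(G,* )$ is called natural if there exists a metric $d$ on the underlying set $G$ such that (i) every right translation $R_g: x \mapsto x*g$, $g \in G$, is an isometry of $(G,d)$, and (ii) whenever $(G,\circ)$ is any group structure on the same set $G$ all of whose right translations are isometries of $(G,d)$, then $(G,\circ)$ is isomorphic to $(G,* )$ as an abstract group. A group $G$ is generalized dicyclic if it is non-abelian and there are an abelian subgroup $A \le G$ of index $2$ and an element $x \in G \setminus A$ with $x^4=1$, $x^2 \neq 1$ and $x a x^{-1} = a^{-1}$ for all $a \in A$. $C_2$ denotes the cyclic group of order $2$. *)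

theory Defs
  imports "HOL-Analysis.Abstract_Metric_Spaces" "HOL-Algebra.Product_Groups"
begin

definition metric_isometry :: "'a set \<Rightarrow> ('a \<Rightarrow> 'a \<Rightarrow> real) \<Rightarrow> ('a \<Rightarrow> 'a) \<Rightarrow> bool" where
  "metric_isometry M d f \<longleftrightarrow>
     bij_betw f M M \<and> (\<forall>x\<in>M. \<forall>y\<in>M. d (f x) (f y) = d x y)"

definition right_translations_isometric ::
    "('a, 'b) monoid_scheme \<Rightarrow> ('a \<Rightarrow> 'a \<Rightarrow> real) \<Rightarrow> bool" where
  "right_translations_isometric G d \<longleftrightarrow>
     (\<forall>g\<in>carrier G. metric_isometry (carrier G) d (\<lambda>x. x \<otimes>\<^bsub>G\<^esub> g))"

definition natural_group :: "('a, 'b) monoid_scheme \<Rightarrow> bool" where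
  "natural_group G \<longleftrightarrow> group G \<and>
     (\<exists>d. Metric_space (carrier G) d \<and>
          right_translations_isometric G d \<and>
          (\<forall>H :: 'a monoid.
             group H \<and> carrier H = carrier G \<and> right_translations_isometric H d
             \<longrightarrow> H \<cong> G))"

definition generalized_dicyclic :: "('a, 'b) monoid_scheme \<Rightarrow> bool" where
  "generalized_dicyclic G \<longleftrightarrow> group G \<and> \<not> comm_group G \<and>
     (\<exists>A. subgroup A G \<and> comm_group (G\<lparr>carrier := A\<rparr>) \<and> card (rcosets\<^bsub>G\<^esub> A) = 2 \<and>
        (\<exists>x \<in> carrier G - A.
           x [^]\<^bsub>G\<^esub> (4::nat) = \<one>\<^bsub>G\<^esub> \<and> x [^]\<^bsub>G\<^esub> (2::nat) \<noteq> \<one>\<^bsub>G\<^esub> \<and>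
           (\<forall>a\<in>A. x \<otimes>\<^bsub>G\<^esub> a \<otimes>\<^bsub>G\<^esub> inv\<^bsub>G\<^esub> x = inv\<^bsub>G\<^esub> a)))"

definition finitely_generated_group :: "('a, 'b) monoid_scheme \<Rightarrow> bool" where
  "finitely_generated_group G \<longleftrightarrow> group G \<and>
     (\<exists>S. finite S \<and> S \<subseteq> carrier G \<and> generate G S = carrier G)"

end

theory Submission
  imports Defs "HOL-Algebra.Multiplicative_Group" "HOL-Algebra.Sylow" "HOL-Library.Countable_Set"
begin

text \<open>
  A metric for which right translations are isometries is a function \<open>\<phi>(x y\<inverse>)\<close> with
  \<open>\<phi>(w) = \<phi>(w\<inverse>)\<close>, so it can tell quotients \<open>x y\<inverse>\<close> apart at best up to inversion. As \<open>G\<close> is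
  countable, some metric attains this bound: all distances between distinct points lie in
  \<open>(1, 2]\<close>, which makes the triangle inequality automatic, and each class \<open>{w, w\<inverse>}\<close> receives its
  own value (\<open>exists_metric_determining_quotients\<close>). After a right translation, an isometry of that
  metric fixes \<open>\<one>\<close> and maps every quotient to itself or its inverse; in particular
  every point is fixed or inverted.

  The core is the analysis of such maps \<open>f\<close> (\<open>quotient_preserving_cases\<close>). If \<open>x\<close> is fixed and \<open>y\<close>
  is not, then \<open>y\<close> conjugates \<open>x\<close> to \<open>x\<inverse>\<close>. When \<open>f\<close> is not the identity and the fixed points form a
  subgroup containing some \<open>x\<close> with \<open>x\<^sup>2 \<noteq> \<one>\<close>, that subgroup is therefore abelian of index 2 and inverted by every
  point outside it: \<open>G\<close> is generalized dicyclic. When fixed points \<open>p\<close>, \<open>q\<close> have a product that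
  is not fixed, they generate a quaternion group, and the centralizer of \<open>p\<close> is an abelian
  subgroup of index 2 inverted by \<open>q\<close>. The remaining case is global inversion,
  which on a non-abelian group again forces a quaternion subgroup and a centralizer of the same
  kind. So for \<open>G\<close> neither abelian nor generalized dicyclic, right translations are
  the only isometries, and a second group law with isometric right translations must agree with
  the first up to isomorphism. For abelian \<open>G\<close> there are also the maps \<open>x \<mapsto> x\<inverse> k\<close>. These are
  involutions, so they are not translations of a group of odd order, and they are translations of
  \<open>G\<close> if \<open>G\<close> has exponent 2.

  Conversely, let \<open>A\<close> be a subgroup of index 2 and \<open>\<iota>\<close> an endomorphism that fixes or inverts
  every element and inverts all elements outside \<open>A\<close>. Then \<open>\<iota>\<close> is an isometry for every
  right invariant metric, and the translations by elements of \<open>A\<close> together with the maps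
  \<open>g \<mapsto> \<iota>(g) h\<close>, \<open>h \<notin> A\<close>, are the right translations of another group in which
  every \<open>h \<notin> A\<close> is an involution (\<open>twisted_group\<close>). For generalized dicyclic \<open>G\<close> take \<open>\<iota>\<close>
  to be the identity on \<open>A\<close>: the new group is generated by involutions, whereas all involutions of
  \<open>G\<close> lie in \<open>A\<close>. For abelian \<open>G\<close> take \<open>\<iota>\<close> to be inversion: the new group is isomorphic to \<open>G\<close>
  only if \<open>G\<close> has exponent 2. Finally, a finitely generated abelian group without a subgroup of
  index 2 equals its subgroup of squares and is therefore finite of odd order
  (\<open>finite_odd_if_no_index_two\<close>), and one of exponent 2 is a finite power of the group of order 2.
\<close>

section \<open>Recognising generalized dicyclic groups\<close>

text \<open>
  That \<open>y\<close> conjugates \<open>x\<close> to its inverse is written \<open>x \<otimes> y \<otimes> x = y\<close> throughout, a form free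
  of inverses that cancellation can be applied to directly.
\<close>

lemma (in group) inverting_compose:
  assumes [simp]: "x \<in> carrier G" "v \<in> carrier G" "w \<in> carrier G"
    and v: "x \<otimes> v \<otimes> x = v" and w: "x \<otimes> w \<otimes> x = w"
  shows "x \<otimes> (w \<otimes> v) = w \<otimes> v \<otimes> x"
proof -
  have "x \<otimes> (w \<otimes> v) = x \<otimes> (w \<otimes> (x \<otimes> v \<otimes> x))"
    using v by simp
  also have "\<dots> = (x \<otimes> w \<otimes> x) \<otimes> v \<otimes> x"
    by (simp add: m_assoc)
  finally show ?thesis
    using w by simp
qed

lemma (in group) inverting_conj:
  assumes [simp]: "x \<in> carrier G" "y \<in> carrier G" and "x \<otimes> y \<otimes> x = y"
  shows "y \<otimes> x \<otimes> inv y = inv x"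
proof -
  have "x \<otimes> (y \<otimes> x \<otimes> inv y) = (x \<otimes> y \<otimes> x) \<otimes> inv y"
    by (simp add: m_assoc)
  then show ?thesis
    using assms by (metis inv_closed inv_solve_left' m_closed r_inv r_one)
qed

text \<open>
  Two properties required of a generalized dicyclic group come for free. As \<open>y\<close> inverts \<open>a\<close>, \<open>b\<close>
  and \<open>a b\<close>, inversion is an endomorphism of \<open>A\<close>, so \<open>A\<close> is abelian. As \<open>y\<^sup>2\<close> lies in \<open>A\<close>, it is
  inverted by \<open>y\<close>, with which it commutes, so \<open>y\<^sup>4 = \<one>\<close>.
\<close>

lemma (in group) generalized_dicyclicI:
  assumes A: "subgroup A G" and y: "y \<in> carrier G" "y \<notin> A"
    and invert: "\<And>a. a \<in> A \<Longrightarrow> a \<otimes> y \<otimes> a = y"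
    and idx: "\<And>w. w \<in> carrier G \<Longrightarrow> w \<notin> A \<Longrightarrow> w \<otimes> y \<in> A"
    and y2: "y \<otimes> y \<noteq> \<one>" and nc: "\<not> comm_group G"
  shows "generalized_dicyclic G"
proof -
  interpret A: subgroup A G by fact
  note [simp] = y(1)
  have comm: "a \<otimes> b = b \<otimes> a" if "a \<in> A" "b \<in> A" for a b
  proof -
    have [simp]: "a \<in> carrier G" "b \<in> carrier G"
      using that by auto
    have "a \<otimes> b \<otimes> (y \<otimes> (a \<otimes> b)) = a \<otimes> (y \<otimes> a)"
      using invert[of "a \<otimes> b"] invert[of a] that by (simp add: m_assoc)
    then have "b \<otimes> y \<otimes> (a \<otimes> b) = y \<otimes> a"
      by (simp add: m_assoc)
    also have "\<dots> = b \<otimes> y \<otimes> b \<otimes> a"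
      using invert[OF that(2)] by simp
    finally have "b \<otimes> y \<otimes> (a \<otimes> b) = b \<otimes> y \<otimes> (b \<otimes> a)"
      by (simp add: m_assoc)
    then show ?thesis
      by simp
  qed
  have "comm_group (G\<lparr>carrier := A\<rparr>)"
    by (rule group.group_comm_groupI[OF A.subgroup_is_group[OF group_axioms]]) (simp add: comm)
  moreover have "card (rcosets A) = 2"
  proof -
    \<comment> \<open>From \<open>w = (w y) y\<inverse>\<close> with \<open>w y \<in> A\<close>, the only coset besides \<open>A\<close> is that of \<open>y\<inverse>\<close>.\<close>
    have "A #> w = A #> inv y" if "w \<in> carrier G" "w \<notin> A" for w
    proof -
      have "w \<otimes> y \<otimes> inv y \<in> A #> inv y"
        using rcosI[OF idx[OF that] A.subset] by simp
      then have "w \<in> A #> inv y"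
        using that by (simp add: m_assoc)
      then show ?thesis
        using repr_independence[OF _ _ A] by simp
    qed
    moreover have "A #> w = A" if "w \<in> A" for w
      using coset_join2[OF _ A that] that by auto
    moreover have "A #> inv y \<noteq> A"
    proof
      assume "A #> inv y = A"
      then have "inv y \<in> A"
        using coset_join1[OF _ _ A] by auto
      then show False
        using A.m_inv_closed[of "inv y"] y by simp
    qed
    moreover have "A \<in> rcosets A"
      using rcosetsI[OF A.subset one_closed] A.subset by simp
    moreover have "A #> inv y \<in> rcosets A"
      using rcosetsI[OF A.subset] by simp
    moreover have "rcosets A \<subseteq> {A, A #> inv y}"
      using calculation(1,2) by (auto simp: RCOSETS_def)
    ultimately have "rcosets A = {A, A #> inv y}" "A \<noteq> A #> inv y"
      by auto
    then show ?thesis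
      by simp
  qed
  moreover have "y [^] (4::nat) = \<one>"
  proof -
    have "y \<otimes> y \<otimes> y \<otimes> (y \<otimes> y) = y"
      using invert[OF idx[OF y]] .
    then have "y \<otimes> (y \<otimes> y \<otimes> (y \<otimes> y)) = y \<otimes> \<one>"
      by (simp add: m_assoc)
    then have "y \<otimes> y \<otimes> (y \<otimes> y) = \<one>"
      by (subst (asm) Units_l_cancel) auto
    then show ?thesis
      by (simp add: numeral_eq_Suc m_assoc)
  qed
  moreover have "y [^] (2::nat) \<noteq> \<one>"
    using y2 by (simp add: numeral_eq_Suc)
  moreover have "y \<otimes> a \<otimes> inv y = inv a" if "a \<in> A" for a
    using inverting_conj invert that by auto
  ultimately show ?thesis
    unfolding generalized_dicyclic_def using A y nc group_axioms by blast
qed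

text \<open>
  Both quaternion situations below lead to this criterion, with the centralizer of \<open>p\<close> as the
  abelian subgroup: its index is 2 because any two elements outside it invert \<open>p\<close>,
  so that their product centralizes \<open>p\<close>.
\<close>

lemma (in group) generalized_dicyclic_centralizerI:
  assumes p: "p \<in> carrier G" and q: "q \<in> carrier G" "p \<otimes> q \<noteq> q \<otimes> p" "q \<otimes> q \<noteq> \<one>"
    and inside: "\<And>z. z \<in> carrier G \<Longrightarrow> p \<otimes> z = z \<otimes> p \<Longrightarrow> z \<otimes> q \<otimes> z = q"
    and outside: "\<And>w. w \<in> carrier G \<Longrightarrow> p \<otimes> w \<noteq> w \<otimes> p \<Longrightarrow> p \<otimes> w \<otimes> p = w"
  shows "generalized_dicyclic G"
proof (rule generalized_dicyclicI)
  let ?A = "{z \<in> carrier G. p \<otimes> z = z \<otimes> p}"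
  note [simp] = p q(1)
  show "subgroup ?A G"
  proof (rule subgroupI)
    fix a b assume "a \<in> ?A" "b \<in> ?A"
    then have ab: "a \<in> carrier G" "b \<in> carrier G" "p \<otimes> a = a \<otimes> p" "p \<otimes> b = b \<otimes> p"
      by simp_all
    note [simp] = ab(1,2)
    have "p \<otimes> (a \<otimes> b) = p \<otimes> a \<otimes> b"
      by (simp add: m_assoc)
    also have "\<dots> = a \<otimes> (p \<otimes> b)"
      unfolding ab(3) by (simp add: m_assoc)
    also have "\<dots> = a \<otimes> b \<otimes> p"
      unfolding ab(4) by (simp add: m_assoc)
    finally show "a \<otimes> b \<in> ?A"
      using ab by simp
  next
    fix a assume "a \<in> ?A"
    then have a: "a \<in> carrier G" "p \<otimes> a = a \<otimes> p"
      by auto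
    note [simp] = a(1)
    have "inv a \<otimes> p = inv a \<otimes> (p \<otimes> a) \<otimes> inv a"
      by (simp add: m_assoc)
    also have "\<dots> = inv a \<otimes> (a \<otimes> p) \<otimes> inv a"
      by (simp only: a(2))
    also have "\<dots> = p \<otimes> inv a"
      by (simp add: inv_solve_left' flip: m_assoc)
    finally have "p \<otimes> inv a = inv a \<otimes> p"
      by (rule sym)
    then show "inv a \<in> ?A"
      using a by simp
  next
    have "\<one> \<in> ?A"
      by simp
    then show "?A \<noteq> {}"
      by blast
  qed auto
  show "w \<otimes> q \<in> ?A" if "w \<in> carrier G" "w \<notin> ?A" for w
  proof -
    have "p \<otimes> (w \<otimes> q) = w \<otimes> q \<otimes> p"
      using that by (intro inverting_compose outside q) auto
    then show ?thesis
      using that by simp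
  qed
  show "\<not> comm_group G"
    using q comm_groupE(4)[of G p q] by auto
qed (use q inside in auto)

text \<open>
  This is the case where global inversion preserves quotients. If \<open>x\<close> and \<open>y\<close> do not commute, then
  neither do \<open>x y\<close> and \<open>y\<close>, and \<open>(x y)\<^sup>2 = y\<^sup>2\<close> says that \<open>y\<close> inverts \<open>x\<close>. Hence
  non-commuting elements invert each other, and the centralizer of \<open>x\<close> is as required.
\<close>

lemma (in group) generalized_dicyclic_if_commute_or_eq_squares:
  assumes nc: "\<not> comm_group G"
    and squares: "\<And>x y. x \<in> carrier G \<Longrightarrow> y \<in> carrier G \<Longrightarrow> x \<otimes> y = y \<otimes> x \<or> x \<otimes> x = y \<otimes> y"
  shows "generalized_dicyclic G"
proof -
  have inverts: "x \<otimes> y \<otimes> x = y"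
    if [simp]: "x \<in> carrier G" "y \<in> carrier G" and ne: "x \<otimes> y \<noteq> y \<otimes> x" for x y
  proof -
    have "x \<otimes> y \<otimes> y \<noteq> y \<otimes> (x \<otimes> y)"
    proof
      assume "x \<otimes> y \<otimes> y = y \<otimes> (x \<otimes> y)"
      then have "x \<otimes> y \<otimes> y = y \<otimes> x \<otimes> y"
        by (simp add: m_assoc)
      with ne show False
        by (subst (asm) right_cancel) auto
    qed
    then have "x \<otimes> y \<otimes> (x \<otimes> y) = y \<otimes> y"
      using squares[of "x \<otimes> y" y] by simp
    then have "x \<otimes> y \<otimes> x \<otimes> y = y \<otimes> y"
      by (simp add: m_assoc)
    then show ?thesis
      by (subst (asm) right_cancel) auto
  qed
  obtain x y where [simp]: "x \<in> carrier G" "y \<in> carrier G" and ne: "x \<otimes> y \<noteq> y \<otimes> x"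
    using nc group_comm_groupI by blast
  show ?thesis
  proof (rule generalized_dicyclic_centralizerI[of x y])
    show "y \<otimes> y \<noteq> \<one>"
    proof
      assume y2: "y \<otimes> y = \<one>"
      have "x \<otimes> y = (y \<otimes> x \<otimes> y) \<otimes> y"
        using inverts[of y x] ne by simp
      also have "\<dots> = y \<otimes> x"
        using y2 by (simp add: m_assoc)
      finally show False
        using ne by simp
    qed
    fix z assume [simp]: "z \<in> carrier G" and xz: "x \<otimes> z = z \<otimes> x"
    \<comment> \<open>If \<open>z\<close> commutes with \<open>y\<close>, then \<open>z x\<close> does not, so \<open>y\<close> inverts \<open>z x\<close> and \<open>x\<close>; this forces \<open>z\<^sup>2 = \<one>\<close>.\<close>
    show "z \<otimes> y \<otimes> z = y"
    proof (cases "z \<otimes> y = y \<otimes> z")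
      case True
      have "z \<otimes> x \<otimes> y \<noteq> y \<otimes> (z \<otimes> x)"
      proof
        assume "z \<otimes> x \<otimes> y = y \<otimes> (z \<otimes> x)"
        also have "\<dots> = z \<otimes> (y \<otimes> x)"
          using True by (simp flip: m_assoc)
        finally show False
          using ne by (simp add: m_assoc)
      qed
      then have "y = z \<otimes> x \<otimes> y \<otimes> (z \<otimes> x)"
        using inverts[of "z \<otimes> x" y] by simp
      also have "\<dots> = z \<otimes> (x \<otimes> (y \<otimes> z)) \<otimes> x"
        by (simp add: m_assoc)
      also have "\<dots> = z \<otimes> (x \<otimes> z) \<otimes> y \<otimes> x"
        by (simp add: m_assoc flip: True)
      also have "\<dots> = z \<otimes> z \<otimes> (x \<otimes> y \<otimes> x)"
        by (simp add: m_assoc xz)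
      also have "\<dots> = z \<otimes> (z \<otimes> y)"
        using inverts[of x y] ne by (simp add: m_assoc)
      also have "\<dots> = z \<otimes> y \<otimes> z"
        by (simp add: m_assoc flip: True)
      finally show ?thesis
        by simp
    qed (use inverts in auto)
  qed (use inverts ne in auto)
qed

section \<open>Maps preserving quotients up to inversion\<close>

text \<open>
  These are the maps that fix \<open>\<one>\<close> and preserve every right invariant metric.
\<close>

definition (in group) quotient_preserving :: "('a \<Rightarrow> 'a) \<Rightarrow> bool" where
  "quotient_preserving f \<longleftrightarrow> f \<in> carrier G \<rightarrow> carrier G \<and> f \<one> = \<one> \<and>
     (\<forall>x\<in>carrier G. \<forall>y\<in>carrier G. f x \<otimes> inv f y \<in> {x \<otimes> inv y, inv (x \<otimes> inv y)})"

context group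
begin

context
  fixes f :: "'a \<Rightarrow> 'a"
  assumes f: "quotient_preserving f"
begin

lemma quotient_preserving_dest:
  assumes "x \<in> carrier G" "y \<in> carrier G"
  shows "f x \<otimes> inv f y = x \<otimes> inv y \<or> f x \<otimes> inv f y = y \<otimes> inv x"
  using f assms by (auto simp: quotient_preserving_def inv_mult_group)

lemma fixes_or_inverts:
  assumes "x \<in> carrier G"
  shows "f x = x \<or> f x = inv x"
  using quotient_preserving_dest[OF assms one_closed] f assms
  by (auto simp: quotient_preserving_def Pi_iff)

text \<open>
  Comparing the quotient \<open>x y\<inverse>\<close> with its image \<open>x y\<close> leaves two options: \<open>y = y\<inverse>\<close>, which is
  excluded because \<open>y\<close> is not fixed, or \<open>x y = y x\<inverse>\<close>.
\<close>

lemma fixed_inverted: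
  assumes [simp]: "x \<in> carrier G" "y \<in> carrier G" and "f x = x" "f y \<noteq> y"
  shows "x \<otimes> y \<otimes> x = y"
proof -
  have fy: "f y = inv y"
    using fixes_or_inverts assms by blast
  then have "y \<otimes> y \<noteq> \<one>"
    using assms inv_equality by fastforce
  from fy have "x \<otimes> y = x \<otimes> inv y \<or> x \<otimes> y = y \<otimes> inv x"
    using quotient_preserving_dest[of x y] assms by simp
  then show ?thesis
  proof
    assume "x \<otimes> y = x \<otimes> inv y"
    then have "inv y = y"
      by simp
    with fy assms(4) show ?thesis
      by simp
  qed (simp add: m_assoc)
qed

text \<open>
  The image \<open>x\<inverse> y\<close> of the quotient \<open>x y\<inverse>\<close> equals \<open>x y\<inverse>\<close> exactly if \<open>x\<^sup>2 = y\<^sup>2\<close>, and it equals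
  \<open>y x\<inverse>\<close> exactly if \<open>x\<close> and \<open>y\<close> commute.
\<close>

lemma inverted_inverted:
  assumes [simp]: "x \<in> carrier G" "y \<in> carrier G" and "f x = inv x" "f y = inv y"
  shows "x \<otimes> y = y \<otimes> x \<or> x \<otimes> x = y \<otimes> y"
proof -
  have "inv x \<otimes> y = x \<otimes> inv y \<or> inv x \<otimes> y = y \<otimes> inv x"
    using quotient_preserving_dest[of x y] assms by simp
  then show ?thesis
  proof
    assume "inv x \<otimes> y = x \<otimes> inv y"
    then have "y \<otimes> y = x \<otimes> x"
      by (metis assms(1,2) inv_closed inv_solve_left inv_solve_right m_assoc m_closed)
    then show ?thesis
      by simp
  next
    assume "inv x \<otimes> y = y \<otimes> inv x"
    then show ?thesis
      by (metis assms(1,2) inv_closed inv_solve_left inv_solve_right m_assoc m_closed)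
  qed
qed

lemma fixed_inv:
  assumes [simp]: "x \<in> carrier G" and x: "f x = x"
  shows "f (inv x) = inv x"
proof (rule ccontr)
  assume "f (inv x) \<noteq> inv x"
  then have "f (inv x) = x"
    using fixes_or_inverts[of "inv x"] by simp
  then have "\<one> = x \<otimes> x \<or> \<one> = inv x \<otimes> inv x"
    using quotient_preserving_dest[of x "inv x"] x by simp
  then have "inv x = x"
    using inv_equality[of x x] inv_equality[of "inv x" "inv x"] by auto
  then show False
    using \<open>f (inv x) = x\<close> \<open>f (inv x) \<noteq> inv x\<close> by simp
qed

text \<open>
  As \<open>p q\<close> inverts both \<open>p\<close> and \<open>q\<close>, the two generate a quaternion group: they invert each other
  and have the same square, which is not \<open>\<one>\<close>. An element commuting with \<open>p\<close> does not invert it,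
  so it is fixed and inverted by \<open>p q\<close>, hence by \<open>q\<close>. An element \<open>w\<close> not commuting with \<open>p\<close> inverts
  it: this is clear if \<open>w\<close> is not fixed; otherwise \<open>w p\<close> is not fixed and inverts \<open>p\<close>.
\<close>

lemma dicyclic_if_fixed_mult_not_fixed:
  assumes [simp]: "p \<in> carrier G" "q \<in> carrier G"
    and p: "f p = p" and q: "f q = q" and pq: "f (p \<otimes> q) \<noteq> p \<otimes> q"
  shows "generalized_dicyclic G"
proof -
  have prp: "p \<otimes> (p \<otimes> q) \<otimes> p = p \<otimes> q" and qrq: "q \<otimes> (p \<otimes> q) \<otimes> q = p \<otimes> q"
    using fixed_inverted p q pq by auto
  have pqp: "p \<otimes> q \<otimes> p = q"
    using prp by (simp add: m_assoc)
  have qpq: "q \<otimes> p \<otimes> q = p"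
  proof -
    have "q \<otimes> p \<otimes> q \<otimes> q = p \<otimes> q"
      using qrq by (simp add: m_assoc)
    then show ?thesis
      by (subst (asm) right_cancel) auto
  qed
  have sq: "p \<otimes> p = q \<otimes> q"
    using arg_cong[OF qpq, of "\<lambda>t. p \<otimes> t"] pqp by (simp flip: m_assoc)
  have "p \<otimes> q \<otimes> (p \<otimes> q) = q \<otimes> q"
    using pqp by (simp flip: m_assoc)
  moreover have "p \<otimes> q \<otimes> (p \<otimes> q) \<noteq> \<one>"
    using pq fixes_or_inverts[of "p \<otimes> q"] inv_equality[of "p \<otimes> q" "p \<otimes> q"] by fastforce
  ultimately have q2: "q \<otimes> q \<noteq> \<one>"
    by simp
  show ?thesis
  proof (rule generalized_dicyclic_centralizerI[of p q])
    show "p \<otimes> q \<noteq> q \<otimes> p"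
    proof
      assume "p \<otimes> q = q \<otimes> p"
      then have "q \<otimes> (p \<otimes> p) = q \<otimes> \<one>"
        using pqp by (simp add: m_assoc)
      then have "p \<otimes> p = \<one>"
        by (subst (asm) Units_l_cancel) auto
      then show False
        using q2 sq by simp
    qed
  next
    fix z assume [simp]: "z \<in> carrier G" and pz: "p \<otimes> z = z \<otimes> p"
    have "f z = z"
    proof (rule ccontr)
      assume "f z \<noteq> z"
      then have "p \<otimes> z \<otimes> p = z"
        using fixed_inverted p by simp
      then have "z \<otimes> (p \<otimes> p) = z \<otimes> \<one>"
        using pz by (simp add: m_assoc)
      then have "p \<otimes> p = \<one>"
        by (subst (asm) Units_l_cancel) auto
      then show False
        using q2 sq by simp
    qed
    then have "z \<otimes> (p \<otimes> q) \<otimes> z = p \<otimes> q"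
      using fixed_inverted pq by simp
    moreover have "z \<otimes> (p \<otimes> q) \<otimes> z = p \<otimes> (z \<otimes> q \<otimes> z)"
      by (simp flip: m_assoc add: pz)
    ultimately show "z \<otimes> q \<otimes> z = q"
      by simp
  next
    fix w assume [simp]: "w \<in> carrier G" and pw: "p \<otimes> w \<noteq> w \<otimes> p"
    show "p \<otimes> w \<otimes> p = w"
    proof (cases "f w = w")
      case True
      \<comment> \<open>If \<open>p\<close>, \<open>w\<close> and \<open>w p\<close> were all fixed, \<open>r = p q\<close> would invert all three, and \<open>p\<close> and \<open>w\<close> would commute.\<close>
      have "f (w \<otimes> p) \<noteq> w \<otimes> p"
      proof
        assume fwp: "f (w \<otimes> p) = w \<otimes> p"
        define r where "r = p \<otimes> q"
        have [simp]: "r \<in> carrier G"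
          by (simp add: r_def)
        have r: "w \<otimes> r \<otimes> w = r" "p \<otimes> r \<otimes> p = r" "w \<otimes> p \<otimes> r \<otimes> (w \<otimes> p) = r"
          using fixed_inverted[of _ "p \<otimes> q"] p True fwp pq by (auto simp: r_def)
        have "r \<otimes> (p \<otimes> w) = r \<otimes> (w \<otimes> p)"
        proof -
          have "w \<otimes> (p \<otimes> r \<otimes> (w \<otimes> p)) = w \<otimes> (r \<otimes> w)"
            using r by (simp add: m_assoc)
          then have "p \<otimes> r \<otimes> (w \<otimes> p) = r \<otimes> w"
            by (subst (asm) Units_l_cancel) auto
          also have "\<dots> = p \<otimes> r \<otimes> (p \<otimes> w)"
            using r(2) by (metis \<open>r \<in> carrier G\<close> \<open>w \<in> carrier G\<close> assms(1) m_assoc m_closed)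
          finally have "p \<otimes> (r \<otimes> (w \<otimes> p)) = p \<otimes> (r \<otimes> (p \<otimes> w))"
            by (simp add: m_assoc)
          then show ?thesis
            by simp
        qed
        then show False
          using pw by simp
      qed
      then have "p \<otimes> (w \<otimes> p) \<otimes> p = w \<otimes> p"
        using fixed_inverted p by simp
      then have "p \<otimes> w \<otimes> p \<otimes> p = w \<otimes> p"
        by (simp add: m_assoc)
      then show ?thesis
        by (subst (asm) right_cancel) auto
    qed (use fixed_inverted p in auto)
  qed (use q2 in auto)
qed

text \<open>
  The abelian subgroup is the set of fixed points. For \<open>w\<close> and \<open>y\<close> not fixed, \<open>w y\<close> centralizes
  \<open>x\<close>, so it does not invert \<open>x\<close> and is therefore fixed; this gives index 2.
\<close>

lemma dicyclic_if_fixed_subgroup: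
  assumes x: "x \<in> carrier G" "f x = x" "x \<otimes> x \<noteq> \<one>" and y: "y \<in> carrier G" "f y \<noteq> y"
    and mult: "\<And>p q. p \<in> carrier G \<Longrightarrow> q \<in> carrier G \<Longrightarrow> f p = p \<Longrightarrow> f q = q \<Longrightarrow> f (p \<otimes> q) = p \<otimes> q"
  shows "generalized_dicyclic G"
proof (rule generalized_dicyclicI)
  let ?A = "{z \<in> carrier G. f z = z}"
  note [simp] = x(1) y(1)
  have xyx: "x \<otimes> y \<otimes> x = y"
    using fixed_inverted x y by simp
  have noncomm: "x \<otimes> y \<noteq> y \<otimes> x"
  proof
    assume "x \<otimes> y = y \<otimes> x"
    then have "y \<otimes> (x \<otimes> x) = y \<otimes> \<one>"
      using xyx by (simp add: m_assoc)
    then show False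
      using x by (subst (asm) Units_l_cancel) auto
  qed
  show "subgroup ?A G"
  proof (rule subgroupI)
    show "?A \<noteq> {}"
      using x by blast
  qed (use fixed_inv mult in auto)
  show "a \<otimes> y \<otimes> a = y" if "a \<in> ?A" for a
    using fixed_inverted y that by simp
  show "w \<otimes> y \<in> ?A" if "w \<in> carrier G" "w \<notin> ?A" for w
  proof (rule ccontr)
    assume "w \<otimes> y \<notin> ?A"
    then have "x \<otimes> (w \<otimes> y) \<otimes> x = w \<otimes> y"
      using fixed_inverted x that by simp
    moreover have "x \<otimes> (w \<otimes> y) = w \<otimes> y \<otimes> x"
      using inverting_compose xyx fixed_inverted x that by simp
    ultimately have "w \<otimes> y \<otimes> (x \<otimes> x) = w \<otimes> y \<otimes> \<one>"
      using that by (simp add: m_assoc)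
    then show False
      using x that by (subst (asm) Units_l_cancel) auto
  qed
  show "y \<otimes> y \<noteq> \<one>"
    using y fixes_or_inverts[of y] inv_equality[of y y] by fastforce
  show "\<not> comm_group G"
    using noncomm comm_groupE(4) by fastforce
qed (use y in auto)

lemma quotient_preserving_cases:
  shows "(\<forall>x\<in>carrier G. f x = x) \<or> (\<forall>x\<in>carrier G. f x = inv x) \<or> generalized_dicyclic G"
proof (rule ccontr)
  assume neg: "\<not> ?thesis"
  then obtain x y where xy: "x \<in> carrier G" "f x \<noteq> inv x" "y \<in> carrier G" "f y \<noteq> y"
    by blast
  then have x: "f x = x" "x \<otimes> x \<noteq> \<one>"
    using fixes_or_inverts[of x] inv_equality[of x x] by auto
  have mult: "f (p \<otimes> q) = p \<otimes> q"
    if "p \<in> carrier G" "q \<in> carrier G" "f p = p" "f q = q" for p q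
  proof (rule ccontr)
    assume "f (p \<otimes> q) \<noteq> p \<otimes> q"
    from dicyclic_if_fixed_mult_not_fixed[OF that this] have "generalized_dicyclic G" .
    with neg show False
      by (elim notE) (intro disjI2)
  qed
  have "generalized_dicyclic G"
    by (rule dicyclic_if_fixed_subgroup[of x y]) (fact xy x mult)+
  with neg show False
    by (elim notE) (intro disjI2)
qed

text \<open>
  Global inversion is excluded: all pairs would then satisfy \<open>inverted_inverted\<close>, which
  makes a non-abelian group generalized dicyclic.
\<close>

theorem quotient_preserving_nonabelian:
  assumes nc: "\<not> comm_group G" and nd: "\<not> generalized_dicyclic G" and "x \<in> carrier G"
  shows "f x = x"
proof -
  have False if all_inv: "\<forall>x\<in>carrier G. f x = inv x"
  proof -
    have "u \<otimes> v = v \<otimes> u \<or> u \<otimes> u = v \<otimes> v" if "u \<in> carrier G" "v \<in> carrier G" for u v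
    proof (rule inverted_inverted)
      show "f u = inv u" "f v = inv v"
        using all_inv that by blast+
    qed fact+
    from generalized_dicyclic_if_commute_or_eq_squares[OF nc this] nd show False
      by simp
  qed
  with quotient_preserving_cases nd have "\<forall>x\<in>carrier G. f x = x"
    by argo
  then show ?thesis
    using assms(3) by (rule bspec)
qed

theorem quotient_preserving_abelian:
  assumes "comm_group G"
  shows "(\<forall>x\<in>carrier G. f x = x) \<or> (\<forall>x\<in>carrier G. f x = inv x)"
proof -
  have "\<not> generalized_dicyclic G"
    using assms by (simp add: generalized_dicyclic_def)
  with quotient_preserving_cases show ?thesis
    by argo
qed

end

end

section \<open>A metric that remembers quotients up to inversion\<close>

text \<open>
  An enumeration \<open>e\<close> of the group gives the class \<open>{g, g\<inverse>}\<close> the number \<open>min (e g) (e (g\<inverse>))\<close>, and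
  distinct classes get distinct numbers. Since every non-zero distance lies in \<open>(1, 2]\<close>, the
  triangle inequality imposes nothing on the choice of values.
\<close>

lemma (in group) exists_metric_determining_quotients:
  assumes "countable (carrier G)"
  obtains d where "Metric_space (carrier G) d" "right_translations_isometric G d"
    "\<And>F. metric_isometry (carrier G) d F \<Longrightarrow> quotient_preserving (\<lambda>x. F x \<otimes> inv F \<one>)"
proof -
  define e where "e = to_nat_on (carrier G)"
  have e_inj: "g = h" if "e g = e h" "g \<in> carrier G" "h \<in> carrier G" for g h
    using inj_on_to_nat_on[OF assms] that unfolding e_def by (auto dest: inj_onD)
  define c where "c g = min (e g) (e (inv g))" for g
  have c_inv: "c (inv g) = c g" if "g \<in> carrier G" for g
    using that by (simp add: c_def min.commute)
  have c_eq: "g = h \<or> g = inv h" if "c g = c h" "g \<in> carrier G" "h \<in> carrier G" for g h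
  proof -
    have "e g = e h \<or> e g = e (inv h) \<or> e (inv g) = e h \<or> e (inv g) = e (inv h)"
      using that(1) unfolding c_def by linarith
    then have "g = h \<or> g = inv h \<or> inv g = h \<or> inv g = inv h"
      using e_inj that(2,3) by (meson inv_closed)
    then show ?thesis
      using that(2,3) by (metis inv_inv)
  qed
  define d :: "'a \<Rightarrow> 'a \<Rightarrow> real" where
    "d x y = (if x \<in> carrier G \<and> y \<in> carrier G \<and> x \<noteq> y then 1 + 1 / (1 + real (c (x \<otimes> inv y))) else 0)"
    for x y
  have d_bounds: "d x y = 0 \<or> 1 < d x y \<and> d x y \<le> 2" for x y
    by (auto simp: d_def field_simps)
  have metric: "Metric_space (carrier G) d"
  proof
    show "0 \<le> d x y" for x y
      using d_bounds[of x y] by auto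
    show "d x y = d y x" for x y
      using c_inv[of "x \<otimes> inv y"] by (auto simp: d_def inv_mult_group)
    show d_zero: "d x y = 0 \<longleftrightarrow> x = y" if "x \<in> carrier G" "y \<in> carrier G" for x y
      using that by (auto simp: d_def add_nonneg_eq_0_iff)
    show "d x z \<le> d x y + d y z"
      if "x \<in> carrier G" "y \<in> carrier G" "z \<in> carrier G" for x y z
    proof (cases "x = y \<or> y = z")
      case True
      moreover have "d u u = 0" for u
        by (simp add: d_def)
      ultimately show ?thesis
        by auto
    next
      case False
      then have "1 < d x y" "1 < d y z"
        using d_bounds[of x y] d_bounds[of y z] d_zero that by auto
      then show ?thesis
        using d_bounds[of x z] by linarith
    qed
  qed
  have quot: "x \<otimes> g \<otimes> inv (y \<otimes> g) = x \<otimes> inv y"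
    if "x \<in> carrier G" "y \<in> carrier G" "g \<in> carrier G" for x y g
  proof -
    have "g \<otimes> (inv g \<otimes> inv y) = inv y"
      using that by (simp flip: m_assoc)
    then show ?thesis
      using that by (simp add: inv_mult_group m_assoc)
  qed
  have shift: "d (x \<otimes> g) (y \<otimes> g) = d x y"
    if "x \<in> carrier G" "y \<in> carrier G" "g \<in> carrier G" for x y g
    using that by (simp add: d_def quot)
  have "bij_betw (\<lambda>x. x \<otimes> g) (carrier G) (carrier G)" if "g \<in> carrier G" for g
    by (rule bij_betwI[where g = "\<lambda>x. x \<otimes> inv g"]) (use that in \<open>auto simp: m_assoc\<close>)
  then have right: "right_translations_isometric G d"
    by (simp add: right_translations_isometric_def metric_isometry_def shift)
  have "quotient_preserving (\<lambda>x. F x \<otimes> inv F \<one>)" if F: "metric_isometry (carrier G) d F" for F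
  proof -
    have F_closed [simp]: "F x \<in> carrier G" if "x \<in> carrier G" for x
      using F that by (auto simp: metric_isometry_def bij_betw_def)
    have "F x \<otimes> inv F y = x \<otimes> inv y \<or> F x \<otimes> inv F y = inv (x \<otimes> inv y)"
      if [simp]: "x \<in> carrier G" "y \<in> carrier G" for x y
    proof (cases "x = y")
      case False
      have "d (F x) (F y) = d x y"
        using F by (simp add: metric_isometry_def)
      moreover from this have "F x \<noteq> F y"
        using False Metric_space.zero[OF metric] by (metis that F_closed)
      ultimately have "c (F x \<otimes> inv F y) = c (x \<otimes> inv y)"
        using False by (simp add: d_def)
      then show ?thesis
        by (rule c_eq) auto
    qed simp
    then show ?thesis
      by (simp add: quotient_preserving_def quot)
  qed
  with metric right show thesis
    by (rule that)
qed

section \<open>Naturality from rigidity\<close>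

text \<open>
  The isomorphism sends \<open>h\<close> to the \<open>k\<close> whose translation in \<open>G\<close> is the translation by \<open>h\<close> in \<open>H\<close>.
  Evaluating at the unit of \<open>G\<close> (which need not be the unit of \<open>H\<close>) shows \<open>k = \<one> \<otimes>\<^bsub>H\<^esub> h\<close>.
\<close>

lemma (in group) iso_if_right_translations_agree:
  fixes H (structure)
  assumes H: "group H" and carrier_eq: "carrier H = carrier G"
    and agree: "\<And>h. h \<in> carrier G \<Longrightarrow> \<exists>k\<in>carrier G. \<forall>x\<in>carrier G. x \<otimes>\<^bsub>H\<^esub> h = x \<otimes>\<^bsub>G\<^esub> k"
  shows "H \<cong> G"
proof -
  interpret H: group H by fact
  define \<kappa> where "\<kappa> h = \<one>\<^bsub>G\<^esub> \<otimes>\<^bsub>H\<^esub> h" for h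
  have one_H: "\<one>\<^bsub>G\<^esub> \<in> carrier H"
    by (simp add: carrier_eq)
  have translate: "x \<otimes>\<^bsub>H\<^esub> h = x \<otimes>\<^bsub>G\<^esub> \<kappa> h" if "x \<in> carrier G" "h \<in> carrier G" for x h
    using agree[OF that(2)] that by (auto simp: \<kappa>_def)
  have "\<kappa> \<in> hom H G"
  proof (rule homI)
    show closed: "\<kappa> h \<in> carrier G" if "h \<in> carrier H" for h
      using H.m_closed[OF one_H that] by (simp add: \<kappa>_def carrier_eq)
    show "\<kappa> (h \<otimes>\<^bsub>H\<^esub> k) = \<kappa> h \<otimes>\<^bsub>G\<^esub> \<kappa> k" if "h \<in> carrier H" "k \<in> carrier H" for h k
      using translate[of "\<kappa> h" k] closed that one_H
      by (simp add: \<kappa>_def carrier_eq flip: H.m_assoc)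
  qed
  moreover have "bij_betw \<kappa> (carrier H) (carrier G)"
    unfolding carrier_eq[symmetric]
    by (rule bij_betwI[where g = "\<lambda>g. inv\<^bsub>H\<^esub> \<one>\<^bsub>G\<^esub> \<otimes>\<^bsub>H\<^esub> g"])
      (use one_H in \<open>auto simp: \<kappa>_def simp flip: H.m_assoc\<close>)
  ultimately show ?thesis
    by (intro is_isoI) (simp add: iso_def)
qed

lemma (in group) mult_eq_if_div_eq:
  assumes "z \<in> carrier G" "k \<in> carrier G" "z \<otimes> inv k = y"
  shows "z = y \<otimes> k"
  using assms by (auto simp: m_assoc)

text \<open>
  Right translations of \<open>H\<close> are isometries, and rigidity makes every isometry a right translation
  of \<open>G\<close>.
\<close>

theorem (in group) natural_if_nonabelian:
  assumes "countable (carrier G)" and nc: "\<not> comm_group G" and nd: "\<not> generalized_dicyclic G"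
  shows "natural_group G"
proof -
  obtain d where d: "Metric_space (carrier G) d" "right_translations_isometric G d"
    and rigid: "\<And>F. metric_isometry (carrier G) d F \<Longrightarrow> quotient_preserving (\<lambda>x. F x \<otimes> inv F \<one>)"
    using exists_metric_determining_quotients assms(1) by blast
  have "H \<cong> G" if H: "group H" "carrier H = carrier G" "right_translations_isometric H d"
    for H :: "'a monoid"
  proof (rule iso_if_right_translations_agree[OF H(1,2)])
    interpret H: group H by fact
    fix h assume h: "h \<in> carrier G"
    define k where "k = \<one> \<otimes>\<^bsub>H\<^esub> h"
    have closed: "x \<otimes>\<^bsub>H\<^esub> h \<in> carrier G" if "x \<in> carrier G" for x
      using H.m_closed h that by (simp add: H(2))
    have k: "k \<in> carrier G"
      by (simp add: k_def closed)
    have "metric_isometry (carrier G) d (\<lambda>x. x \<otimes>\<^bsub>H\<^esub> h)"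
      using H h by (simp add: right_translations_isometric_def)
    then have "quotient_preserving (\<lambda>x. x \<otimes>\<^bsub>H\<^esub> h \<otimes> inv k)"
      unfolding k_def by (rule rigid)
    from quotient_preserving_nonabelian[OF this nc nd]
    have fixes_all: "x \<otimes>\<^bsub>H\<^esub> h \<otimes> inv k = x" if "x \<in> carrier G" for x
      using that .
    have "x \<otimes>\<^bsub>H\<^esub> h = x \<otimes> k" if "x \<in> carrier G" for x
      using mult_eq_if_div_eq[OF closed[OF that] k fixes_all[OF that]] .
    with k show "\<exists>k\<in>carrier G. \<forall>x\<in>carrier G. x \<otimes>\<^bsub>H\<^esub> h = x \<otimes> k"
      by blast
  qed
  with d show ?thesis
    unfolding natural_group_def using group_axioms by blast
qed

text \<open>
  An isometry is now \<open>x \<mapsto> x k\<close> or \<open>x \<mapsto> x\<inverse> k\<close>. A translation of \<open>H\<close> of the second form is an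
  involution, so it comes from an element of order at most 2, which is the unit if the order is
  odd. In exponent 2 both forms coincide.
\<close>

theorem (in comm_group) natural_if_abelian:
  assumes "countable (carrier G)"
    and odd_or_exponent_two: "finite (carrier G) \<and> odd (order G) \<or> (\<forall>x\<in>carrier G. x \<otimes> x = \<one>)"
  shows "natural_group G"
proof -
  obtain d where d: "Metric_space (carrier G) d" "right_translations_isometric G d"
    and rigid: "\<And>F. metric_isometry (carrier G) d F \<Longrightarrow> quotient_preserving (\<lambda>x. F x \<otimes> inv F \<one>)"
    using exists_metric_determining_quotients assms(1) by blast
  have "H \<cong> G" if H: "group H" "carrier H = carrier G" "right_translations_isometric H d"
    for H :: "'a monoid"
  proof (rule iso_if_right_translations_agree[OF H(1,2)])
    interpret H: group H by fact
    fix h assume h: "h \<in> carrier G"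
    define k where "k = \<one> \<otimes>\<^bsub>H\<^esub> h"
    have closed: "x \<otimes>\<^bsub>H\<^esub> h \<in> carrier G" if "x \<in> carrier G" for x
      using H.m_closed h that by (simp add: H(2))
    have k [simp]: "k \<in> carrier G"
      by (simp add: k_def closed)
    have "metric_isometry (carrier G) d (\<lambda>x. x \<otimes>\<^bsub>H\<^esub> h)"
      using H h by (simp add: right_translations_isometric_def)
    then have "quotient_preserving (\<lambda>x. x \<otimes>\<^bsub>H\<^esub> h \<otimes> inv k)"
      unfolding k_def by (rule rigid)
    from quotient_preserving_abelian[OF this comm_group_axioms]
    have "(\<forall>x\<in>carrier G. x \<otimes>\<^bsub>H\<^esub> h = x \<otimes> k) \<or> (\<forall>x\<in>carrier G. x \<otimes>\<^bsub>H\<^esub> h = inv x \<otimes> k)"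
      using mult_eq_if_div_eq[OF closed k] by blast
    then have "\<exists>k\<in>carrier G. \<forall>x\<in>carrier G. x \<otimes>\<^bsub>H\<^esub> h = x \<otimes> k"
    proof
      assume refl: "\<forall>x\<in>carrier G. x \<otimes>\<^bsub>H\<^esub> h = inv x \<otimes> k"
      from odd_or_exponent_two show ?thesis
      proof
        assume "\<forall>x\<in>carrier G. x \<otimes> x = \<one>"
        then have "inv x = x" if "x \<in> carrier G" for x
          using inv_equality that by blast
        then show ?thesis
          using refl by (intro bexI[of _ k]) auto
      next
        assume odd: "finite (carrier G) \<and> odd (order G)"
        have "\<one> \<otimes>\<^bsub>H\<^esub> h \<otimes>\<^bsub>H\<^esub> h = \<one>"
          using refl by simp
        then have "h \<otimes>\<^bsub>H\<^esub> h = \<one>\<^bsub>H\<^esub>"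
          using h closed[OF h] H.l_cancel_one[of "\<one>" "h \<otimes>\<^bsub>H\<^esub> h"] by (simp add: H(2) H.m_assoc)
        then have "h [^]\<^bsub>H\<^esub> (2::nat) = \<one>\<^bsub>H\<^esub>"
          using h by (simp add: numeral_2_eq_2 H(2))
        then have "H.ord h dvd 2"
          using H.pow_eq_id[of h 2] h by (simp add: H(2))
        moreover have "H.ord h dvd order G"
          using H.ord_dvd_group_order[of h] h by (simp add: H(2) order_def)
        ultimately have "H.ord h = 1"
          using odd by (metis prime_nat_iff two_is_prime_nat)
        then have "h = \<one>\<^bsub>H\<^esub>"
          using H.ord_eq_1 h by (simp add: H(2))
        then have "\<forall>x\<in>carrier G. x \<otimes>\<^bsub>H\<^esub> h = x \<otimes> \<one>"
          using H.r_one by (simp add: H(2))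
        then show ?thesis
          by blast
      qed
    qed (use k in blast)
    then show "\<exists>k\<in>carrier G. \<forall>x\<in>carrier G. x \<otimes>\<^bsub>H\<^esub> h = x \<otimes> k" .
  qed
  with d show ?thesis
    unfolding natural_group_def using group_axioms by blast
qed

section \<open>A second regular group of isometries\<close>

lemma (in group) mult_mem_subgroup_left_iff:
  assumes A: "subgroup A G" and a: "a \<in> A" and g: "g \<in> carrier G"
  shows "a \<otimes> g \<in> A \<longleftrightarrow> g \<in> A"
proof
  have a': "a \<in> carrier G"
    by (rule subgroup.mem_carrier[OF A a])
  assume "a \<otimes> g \<in> A"
  then have "inv a \<otimes> (a \<otimes> g) \<in> A"
    using subgroup.m_closed[OF A] subgroup.m_inv_closed[OF A a] by blast
  then show "g \<in> A"
    using a' g by (simp flip: m_assoc)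
qed (rule subgroup.m_closed[OF A a])

lemma (in group) mult_mem_subgroup_right_iff:
  assumes A: "subgroup A G" and a: "a \<in> A" and g: "g \<in> carrier G"
  shows "g \<otimes> a \<in> A \<longleftrightarrow> g \<in> A"
proof
  have a': "a \<in> carrier G"
    by (rule subgroup.mem_carrier[OF A a])
  assume "g \<otimes> a \<in> A"
  then have "g \<otimes> a \<otimes> inv a \<in> A"
    using subgroup.m_closed[OF A] subgroup.m_inv_closed[OF A a] by blast
  then show "g \<in> A"
    using a' g by (simp add: m_assoc)
next
  assume "g \<in> A"
  then show "g \<otimes> a \<in> A"
    by (rule subgroup.m_closed[OF A]) (rule a)
qed

text \<open>
  Right multiplication by \<open>h \<notin> A\<close> is replaced by \<open>\<iota>\<close> followed by that multiplication. For a
  generalized dicyclic group, with \<open>\<iota>\<close> the identity on \<open>A\<close>, the result is the generalized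
  dihedral group of \<open>A\<close>; for an abelian group, with \<open>\<iota>\<close> the inversion, it is so as well.
\<close>

definition twisted_group :: "('a, 'b) monoid_scheme \<Rightarrow> 'a set \<Rightarrow> ('a \<Rightarrow> 'a) \<Rightarrow> 'a monoid" where
  "twisted_group G A \<iota> =
     \<lparr>carrier = carrier G,
      monoid.mult = (\<lambda>g h. if h \<in> A then g \<otimes>\<^bsub>G\<^esub> h else \<iota> g \<otimes>\<^bsub>G\<^esub> h),
      one = \<one>\<^bsub>G\<^esub>\<rparr>"

text \<open>
  The closure condition \<open>index\<close> says that \<open>A\<close> has index at most 2. The condition \<open>inverts\<close> makes
  elements outside \<open>A\<close> involutions of the twisted group, and \<open>fixes_or_inverts\<close> makes \<open>\<iota>\<close> an
  isometry of every right invariant metric.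
\<close>

locale twisting = group G for G (structure) +
  fixes A :: "'a set" and \<iota> :: "'a \<Rightarrow> 'a"
  assumes subgroup_A: "subgroup A G"
    and index: "\<And>g h. g \<in> carrier G \<Longrightarrow> h \<in> carrier G \<Longrightarrow> g \<notin> A \<Longrightarrow> h \<notin> A \<Longrightarrow> g \<otimes> h \<in> A"
    and hom: "\<iota> \<in> hom G G"
    and fixes_or_inverts: "\<And>g. g \<in> carrier G \<Longrightarrow> \<iota> g = g \<or> \<iota> g = inv g"
    and inverts: "\<And>g. g \<in> carrier G \<Longrightarrow> g \<notin> A \<Longrightarrow> \<iota> g = inv g"
begin

lemma mem_A [simp]: "a \<in> A \<Longrightarrow> a \<in> carrier G"
  using subgroup.mem_carrier[OF subgroup_A] .

lemma one_A [simp]: "\<one> \<in> A"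
  using subgroup.one_closed[OF subgroup_A] .

lemma mult_A [simp]: "a \<in> A \<Longrightarrow> b \<in> A \<Longrightarrow> a \<otimes> b \<in> A"
  using subgroup.m_closed[OF subgroup_A] .

lemma inv_A: "g \<in> carrier G \<Longrightarrow> inv g \<in> A \<longleftrightarrow> g \<in> A"
  using subgroup.m_inv_closed[OF subgroup_A, of g] subgroup.m_inv_closed[OF subgroup_A, of "inv g"]
  by auto

lemma mult_A_left [simp]: "a \<in> A \<Longrightarrow> g \<in> carrier G \<Longrightarrow> a \<otimes> g \<in> A \<longleftrightarrow> g \<in> A"
  by (rule mult_mem_subgroup_left_iff[OF subgroup_A])

lemma mult_A_right [simp]: "a \<in> A \<Longrightarrow> g \<in> carrier G \<Longrightarrow> g \<otimes> a \<in> A \<longleftrightarrow> g \<in> A"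
  by (rule mult_mem_subgroup_right_iff[OF subgroup_A])

lemma twist_closed [simp]: "g \<in> carrier G \<Longrightarrow> \<iota> g \<in> carrier G"
  using hom_in_carrier[OF hom] .

lemma twist_mult: "g \<in> carrier G \<Longrightarrow> h \<in> carrier G \<Longrightarrow> \<iota> (g \<otimes> h) = \<iota> g \<otimes> \<iota> h"
  using hom_mult[OF hom] .

lemma twist_one [simp]: "\<iota> \<one> = \<one>"
  using fixes_or_inverts[of \<one>] by simp

lemma twist_inv: "g \<in> carrier G \<Longrightarrow> \<iota> (inv g) = inv (\<iota> g)"
  using group_hom.hom_inv[of G G \<iota> g] hom by (simp add: group_hom_def group_hom_axioms_def)

lemma twist_A [simp]: "g \<in> carrier G \<Longrightarrow> \<iota> g \<in> A \<longleftrightarrow> g \<in> A"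
  using fixes_or_inverts[of g] inv_A[of g] by auto

lemma twist_twist [simp]:
  assumes "g \<in> carrier G"
  shows "\<iota> (\<iota> g) = g"
proof (cases "\<iota> g = g")
  case False
  then have "\<iota> g = inv g"
    using fixes_or_inverts assms by blast
  moreover from this have "\<iota> (inv g) = g"
    using twist_inv[OF assms] assms by simp
  ultimately show ?thesis
    by simp
qed simp

abbreviation H where "H \<equiv> twisted_group G A \<iota>"

lemma carrier_twisted [simp]: "carrier H = carrier G"
  by (simp add: twisted_group_def)

lemma one_twisted [simp]: "\<one>\<^bsub>H\<^esub> = \<one>"
  by (simp add: twisted_group_def)

lemma mult_twisted: "g \<otimes>\<^bsub>H\<^esub> h = (if h \<in> A then g \<otimes> h else \<iota> g \<otimes> h)"
  by (simp add: twisted_group_def)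

lemma twisted_involution: "h \<in> carrier G \<Longrightarrow> h \<notin> A \<Longrightarrow> h \<otimes>\<^bsub>H\<^esub> h = \<one>"
  by (simp add: mult_twisted inverts)

text \<open>
  Associativity rests on \<open>\<iota>\<close> being multiplicative and of order at most 2, together with the
  parity rule that \<open>y z\<close> lies outside \<open>A\<close> exactly if one of \<open>y\<close>, \<open>z\<close> does and the other does not.
\<close>

lemma group_twisted: "group H"
proof (rule groupI)
  fix x y z assume "x \<in> carrier H" "y \<in> carrier H" "z \<in> carrier H"
  then have xyz [simp]: "x \<in> carrier G" "y \<in> carrier G" "z \<in> carrier G"
    by simp_all
  show "x \<otimes>\<^bsub>H\<^esub> y \<in> carrier H"
    by (simp add: mult_twisted)
  show "x \<otimes>\<^bsub>H\<^esub> y \<otimes>\<^bsub>H\<^esub> z = x \<otimes>\<^bsub>H\<^esub> (y \<otimes>\<^bsub>H\<^esub> z)"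
    by (cases "y \<in> A"; cases "z \<in> A") (simp_all add: mult_twisted twist_mult index m_assoc)
  show "\<one>\<^bsub>H\<^esub> \<otimes>\<^bsub>H\<^esub> x = x"
    by (simp add: mult_twisted)
  show "\<exists>y\<in>carrier H. y \<otimes>\<^bsub>H\<^esub> x = \<one>\<^bsub>H\<^esub>"
  proof (cases "x \<in> A")
    case True
    then show ?thesis
      by (intro bexI[of _ "inv x"]) (simp_all add: mult_twisted)
  next
    case False
    then show ?thesis
      using twisted_involution[of x] by (intro bexI[of _ x]) simp_all
  qed
qed simp

text \<open>
  The distance of \<open>x\<close> and \<open>y\<close> is that of \<open>x y\<inverse>\<close> from \<open>\<one>\<close>, and \<open>w\<close>, \<open>w\<inverse>\<close> are equally far from
  \<open>\<one>\<close>. Hence \<open>\<iota>\<close>, which fixes or inverts \<open>x y\<inverse>\<close>, is an isometry.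
\<close>

lemma twisted_right_translations_isometric:
  assumes d: "right_translations_isometric G d" and sym: "\<And>x y. d x y = d y x"
  shows "right_translations_isometric H d"
proof -
  interpret H: group H
    by (rule group_twisted)
  have shift: "d (x \<otimes> g) (y \<otimes> g) = d x y"
    if "x \<in> carrier G" "y \<in> carrier G" "g \<in> carrier G" for x y g
    using d that by (simp add: right_translations_isometric_def metric_isometry_def)
  have d_quot: "d x y = d (x \<otimes> inv y) \<one>" if "x \<in> carrier G" "y \<in> carrier G" for x y
    using shift[of x y "inv y"] that by simp
  have d_inv: "d (inv w) \<one> = d w \<one>" if "w \<in> carrier G" for w
    using shift[of "inv w" \<one> w] that sym[of \<one> w] by simp
  have twist: "d (\<iota> x) (\<iota> y) = d x y" if [simp]: "x \<in> carrier G" "y \<in> carrier G" for x y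
  proof -
    have "d (\<iota> x) (\<iota> y) = d (\<iota> (x \<otimes> inv y)) \<one>"
      by (simp add: d_quot[of "\<iota> x" "\<iota> y"] twist_mult twist_inv)
    also have "\<dots> = d (x \<otimes> inv y) \<one>"
      using fixes_or_inverts[of "x \<otimes> inv y"] d_inv[of "x \<otimes> inv y"] by auto
    finally show ?thesis
      by (simp add: d_quot[of x y])
  qed
  have "bij_betw (\<lambda>x. x \<otimes>\<^bsub>H\<^esub> g) (carrier H) (carrier H)" if "g \<in> carrier H" for g
    by (rule bij_betwI[where g = "\<lambda>x. x \<otimes>\<^bsub>H\<^esub> inv\<^bsub>H\<^esub> g"])
      (use that H.inv_closed[OF that] H.m_closed in \<open>auto simp: H.m_assoc simp del: carrier_twisted one_twisted\<close>)
  then show ?thesis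
    by (simp add: right_translations_isometric_def metric_isometry_def mult_twisted shift twist)
qed

lemma twisted_iso_if_natural:
  assumes "natural_group G"
  shows "H \<cong> G"
proof -
  obtain d where d: "Metric_space (carrier G) d" "right_translations_isometric G d"
    and iso: "\<And>K :: 'a monoid. group K \<and> carrier K = carrier G \<and> right_translations_isometric K d \<Longrightarrow> K \<cong> G"
    using assms unfolding natural_group_def by blast
  have "right_translations_isometric H d"
    by (rule twisted_right_translations_isometric[OF d(2) Metric_space.commute[OF d(1)]])
  then show ?thesis
    using iso[of H] group_twisted by simp
qed

end

text \<open>
  Outside \<open>A\<close> all squares equal the central element \<open>u = x\<^sup>2 \<noteq> \<one>\<close>, so an isomorphism from the twisted
  group, where all elements outside \<open>A\<close> are involutions, maps these into \<open>A\<close>. They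
  generate the twisted group, so the isomorphism would not be onto.
\<close>

theorem not_natural_if_generalized_dicyclic:
  fixes G (structure)
  assumes "generalized_dicyclic G"
  shows "\<not> natural_group G"
proof
  assume nat: "natural_group G"
  from assms interpret group G
    by (simp add: generalized_dicyclic_def)
  obtain A x where A: "subgroup A G" "comm_group (G\<lparr>carrier := A\<rparr>)" "card (rcosets A) = 2"
    and x: "x \<in> carrier G" "x \<notin> A" "x [^] (4::nat) = \<one>" "x [^] (2::nat) \<noteq> \<one>"
    and conj: "\<And>a. a \<in> A \<Longrightarrow> x \<otimes> a \<otimes> inv x = inv a"
    using assms by (auto simp: generalized_dicyclic_def)
  note [simp] = x(1)
  interpret A: subgroup A G by fact
  have comm: "a \<otimes> b = b \<otimes> a" if "a \<in> A" "b \<in> A" for a b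
    using comm_groupE(4)[OF A(2)] that by simp
  have coset: "\<exists>a\<in>A. g = a \<otimes> x" if g: "g \<in> carrier G" "g \<notin> A" for g
  proof -
    have ne: "A #> h \<noteq> A" if "h \<in> carrier G" "h \<notin> A" for h
      using coset_join1[of A h] that A(1) by blast
    have cosets: "A \<in> rcosets A" "A #> g \<in> rcosets A" "A #> x \<in> rcosets A"
      using rcosetsI[OF A.subset] rcosetsI[OF A.subset one_closed] A.subset g by simp_all
    have "A #> g = A #> x"
    proof (rule ccontr)
      assume "A #> g \<noteq> A #> x"
      then have "card {A, A #> g, A #> x} = 3"
        using ne[OF g] ne[OF x(1,2)] by auto
      moreover have "finite (rcosets A)"
        using A(3) card.infinite by fastforce
      then have "card {A, A #> g, A #> x} \<le> 2"
        using cosets A(3) card_mono[of "rcosets A" "{A, A #> g, A #> x}"] by simp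
      ultimately show False
        by simp
    qed
    then have "g \<in> A #> x"
      using rcos_self[OF g(1) A(1)] by simp
    then show ?thesis
      by (auto simp: r_coset_def)
  qed
  have xa: "x \<otimes> a = inv a \<otimes> x" if "a \<in> A" for a
    using mult_eq_if_div_eq[OF _ _ conj[OF that]] that by simp
  define u where "u = x \<otimes> x"
  have [simp]: "u \<in> carrier G"
    by (simp add: u_def)
  have uu: "u \<otimes> u = \<one>" and u1: "u \<noteq> \<one>"
    using x(3,4) by (simp_all add: u_def numeral_eq_Suc m_assoc)
  have u: "u \<in> A"
  proof (rule ccontr)
    assume "u \<notin> A"
    then obtain a where "a \<in> A" "x \<otimes> x = a \<otimes> x"
      using coset[of u] by (auto simp: u_def)
    then show False
      using x(1,2) by (metis A.mem_carrier right_cancel)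
  qed
  have square: "g \<otimes> g = u" if g: "g \<in> carrier G" "g \<notin> A" for g
  proof -
    obtain a where a: "a \<in> A" "g = a \<otimes> x"
      using coset[OF g] by blast
    then have [simp]: "a \<in> carrier G"
      by simp
    have "g \<otimes> g = a \<otimes> (x \<otimes> a) \<otimes> x"
      using a by (simp add: m_assoc)
    also have "\<dots> = a \<otimes> inv a \<otimes> (x \<otimes> x)"
      by (simp only: xa[OF a(1)]) (simp add: m_assoc flip: m_assoc[of a "inv a" x])
    finally show ?thesis
      by (simp add: u_def)
  qed
  have comm_u: "g \<otimes> u = u \<otimes> g" if g: "g \<in> carrier G" for g
  proof (cases "g \<in> A")
    case True
    then show ?thesis
      using comm u by blast
  next
    case False
    then show ?thesis
      using square[OF g False] g by (simp add: m_assoc flip: square[OF g False])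
  qed
  have inv_eq: "inv g = u \<otimes> g" if g: "g \<in> carrier G" "g \<notin> A" for g
  proof (rule inv_equality)
    show "u \<otimes> g \<otimes> g = \<one>"
      using square[OF g] g uu by (simp add: m_assoc)
  qed (use g in auto)
  \<comment> \<open>As \<open>g\<inverse> = u g\<close> outside \<open>A\<close>, this is the identity on \<open>A\<close> and inversion elsewhere.\<close>
  define \<iota> where "\<iota> g = (if g \<in> A then g else u \<otimes> g)" for g
  have prod_A: "g \<otimes> h \<in> A" if g: "g \<in> carrier G" "g \<notin> A" and h: "h \<in> carrier G" "h \<notin> A" for g h
  proof -
    obtain a b where a: "a \<in> A" "g = a \<otimes> x" and b: "b \<in> A" "h = b \<otimes> x"
      using coset g h by blast
    have "g \<otimes> h = a \<otimes> (x \<otimes> b) \<otimes> x"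
      using a b by (simp add: m_assoc)
    also have "\<dots> = a \<otimes> inv b \<otimes> u"
      unfolding xa[OF b(1)] using a b by (simp add: u_def m_assoc)
    also have "\<dots> \<in> A"
      using a b u by simp
    finally show ?thesis .
  qed
  note left_A = mult_mem_subgroup_left_iff[OF A(1)]
  note right_A = mult_mem_subgroup_right_iff[OF A(1)]
  interpret twisting G A \<iota>
  proof
    show "\<iota> \<in> hom G G"
    proof (rule homI)
      show "\<iota> g \<in> carrier G" if "g \<in> carrier G" for g
        using that by (simp add: \<iota>_def)
      fix g h assume g [simp]: "g \<in> carrier G" and h [simp]: "h \<in> carrier G"
      have gu: "g \<otimes> (u \<otimes> h) = u \<otimes> (g \<otimes> h)"
        using comm_u[OF g] by (simp flip: m_assoc)
      have uu': "u \<otimes> (u \<otimes> h') = h'" if "h' \<in> carrier G" for h'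
        using uu that by (simp flip: m_assoc)
      show "\<iota> (g \<otimes> h) = \<iota> g \<otimes> \<iota> h"
        by (cases "g \<in> A"; cases "h \<in> A")
          (simp_all add: \<iota>_def left_A right_A prod_A m_assoc gu uu')
    qed
  qed (use A(1) prod_A inv_eq in \<open>auto simp: \<iota>_def\<close>)
  have "H \<cong> G"
    by (rule twisted_iso_if_natural[OF nat])
  then obtain \<phi> where \<phi>: "\<phi> \<in> hom H G" "bij_betw \<phi> (carrier G) (carrier G)"
    by (auto simp: is_iso_def iso_def)
  have \<phi>_one: "\<phi> \<one> = \<one>"
    using hom_one[OF \<phi>(1) group_twisted group_axioms] by simp
  have outside: "\<phi> h \<in> A" if h: "h \<in> carrier G" "h \<notin> A" for h
  proof (rule ccontr)
    assume "\<phi> h \<notin> A"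
    moreover have "\<phi> h \<in> carrier G"
      using hom_in_carrier[OF \<phi>(1)] h by simp
    ultimately have "\<phi> h \<otimes> \<phi> h = u"
      using square by blast
    moreover have "\<phi> h \<otimes> \<phi> h = \<phi> (h \<otimes>\<^bsub>H\<^esub> h)"
      using hom_mult[OF \<phi>(1)] h by simp
    ultimately show False
      using u1 twisted_involution[OF h] \<phi>_one by simp
  qed
  have "\<phi> a \<in> A" if "a \<in> carrier G" for a
  proof (cases "a \<in> A")
    case True
    have "\<phi> (a \<otimes>\<^bsub>H\<^esub> x) \<in> A"
      by (rule outside) (use True x in \<open>simp_all add: mult_twisted\<close>)
    moreover have "\<phi> (a \<otimes>\<^bsub>H\<^esub> x) = \<phi> a \<otimes> \<phi> x"
      using hom_mult[OF \<phi>(1)] that by simp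
    ultimately show ?thesis
      using right_A[OF outside[OF x(1,2)]] hom_in_carrier[OF \<phi>(1)] that by simp
  qed (use outside that in blast)
  then have "\<phi> ` carrier G \<subseteq> A"
    by blast
  then have "carrier G \<subseteq> A"
    using \<phi>(2) by (simp add: bij_betw_def)
  then show False
    using x by blast
qed

text \<open>
  Twisting by inversion yields a group that is isomorphic to \<open>G\<close>, hence abelian, and in which the
  elements outside \<open>A\<close> are involutions. For \<open>a \<in> A\<close> both \<open>w\<close> and \<open>a w\<close> are such, so \<open>a\<^sup>2\<close> is
  trivial as well.
\<close>

lemma (in comm_group) exponent_two_if_natural:
  assumes nat: "natural_group G" and A: "subgroup A G"
    and w: "w \<in> carrier G" "w \<notin> A"
    and index: "\<And>g h. g \<in> carrier G \<Longrightarrow> h \<in> carrier G \<Longrightarrow> g \<notin> A \<Longrightarrow> h \<notin> A \<Longrightarrow> g \<otimes> h \<in> A"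
    and y: "y \<in> carrier G"
  shows "y \<otimes> y = \<one>"
proof -
  interpret twisting G A "\<lambda>g. inv g"
    by (intro twisting.intro twisting_axioms.intro homI)
      (use A index group_axioms in \<open>auto simp: inv_mult\<close>)
  have iso: "H \<cong> G"
    by (rule twisted_iso_if_natural[OF nat])
  have "comm_group H"
    by (rule iso_imp_comm_group[OF group.iso_sym[OF group_twisted iso] group.is_monoid[OF group_twisted]])
  then interpret H: comm_group H .
  have H_closed: "g \<otimes>\<^bsub>H\<^esub> h \<in> carrier G" if "g \<in> carrier G" "h \<in> carrier G" for g h
    using H.m_closed[of g h] that by simp
  have exp_H: "y \<otimes>\<^bsub>H\<^esub> y = \<one>" if y: "y \<in> carrier G" for y
  proof (cases "y \<in> A")
    case True
    have yw: "y \<otimes>\<^bsub>H\<^esub> w \<in> carrier G" "y \<otimes>\<^bsub>H\<^esub> w \<notin> A"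
      using True w y by (simp_all add: mult_twisted)
    have "\<one> = y \<otimes>\<^bsub>H\<^esub> w \<otimes>\<^bsub>H\<^esub> (y \<otimes>\<^bsub>H\<^esub> w)"
      using twisted_involution[OF yw] by simp
    also have "\<dots> = y \<otimes>\<^bsub>H\<^esub> y \<otimes>\<^bsub>H\<^esub> (w \<otimes>\<^bsub>H\<^esub> w)"
      using y w by (simp add: H_closed H.m_assoc[simplified] H.m_comm[simplified] H.m_lcomm[simplified])
    also have "\<dots> = y \<otimes>\<^bsub>H\<^esub> y"
      using twisted_involution[OF w] y H.r_one[of "y \<otimes>\<^bsub>H\<^esub> y"] H.m_closed[of y y] by simp
    finally show ?thesis
      by simp
  qed (use twisted_involution y in blast)
  obtain \<phi> where \<phi>: "\<phi> \<in> hom H G" "bij_betw \<phi> (carrier G) (carrier G)"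
    using iso by (auto simp: is_iso_def iso_def)
  obtain z where z: "z \<in> carrier G" "y = \<phi> z"
    using \<phi>(2) y by (auto simp: bij_betw_def)
  have "y \<otimes> y = \<phi> (z \<otimes>\<^bsub>H\<^esub> z)"
    using hom_mult[OF \<phi>(1)] z by simp
  then show ?thesis
    using exp_H[OF z(1)] hom_one[OF \<phi>(1) group_twisted group_axioms] by simp
qed

section \<open>Finitely generated abelian groups\<close>

lemma (in group) countable_generate:
  assumes "countable S" and S: "S \<subseteq> carrier G"
  shows "countable (generate G S)"
proof -
  define T where "T = S \<union> (\<lambda>s. inv s) ` S"
  have T: "T \<subseteq> carrier G"
    using S by (auto simp: T_def)
  define word where "word ws = foldr (\<otimes>) ws \<one>" for ws
  have word_Nil [simp]: "word [] = \<one>" and word_Cons [simp]: "word (u # us) = u \<otimes> word us" for u us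
    by (simp_all add: word_def)
  have word_closed: "word ws \<in> carrier G" if "ws \<in> lists T" for ws
    using that
  proof (induction ws)
    case (Cons u us)
    then have "u \<in> carrier G"
      using T by auto
    with Cons show ?case
      by simp
  qed simp
  have word_append: "word (us @ vs) = word us \<otimes> word vs"
    if "us \<in> lists T" "vs \<in> lists T" for us vs
    using that(1)
  proof (induction us)
    case Nil
    then show ?case
      using word_closed[OF that(2)] by simp
  next
    case (Cons u us)
    then have "u \<in> carrier G"
      using T by auto
    with Cons show ?case
      using word_closed[OF that(2)] word_closed[of us] by (simp add: m_assoc)
  qed
  have letter: "u \<in> word ` lists T" if "u \<in> T" for u
  proof -
    have "word [u] = u" "[u] \<in> lists T"
      using that T by auto
    then show ?thesis
      by (metis image_eqI)
  qed
  have "x \<in> word ` lists T" if "x \<in> generate G S" for x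
    using that
  proof induction
    case one
    show ?case
      using image_eqI[of \<one> word "[]" "lists T"] by simp
  next
    case (eng x y)
    then obtain us vs where uv: "us \<in> lists T" "vs \<in> lists T" "x = word us" "y = word vs"
      by blast
    then have "x \<otimes> y = word (us @ vs)" "us @ vs \<in> lists T"
      by (simp_all add: word_append)
    then show ?case
      by (rule image_eqI)
  qed (rule letter, simp add: T_def)+
  then have "generate G S \<subseteq> word ` lists T"
    by blast
  moreover have "countable (word ` lists T)"
    using assms(1) by (intro countable_image countable_lists) (simp add: T_def)
  ultimately show ?thesis
    by (rule countable_subset)
qed

lemma (in comm_group) generate_insert_elements:
  assumes s: "s \<in> carrier G" and T: "T \<subseteq> carrier G" and x: "x \<in> generate G (insert s T)"
  obtains k :: int and t where "t \<in> generate G T" "x = s [^] k \<otimes> t"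
proof -
  note [simp] = s generate_in_carrier[OF T]
  have "\<exists>k :: int. \<exists>t\<in>generate G T. x = s [^] k \<otimes> t"
    using x
  proof induction
    case one
    show ?case
      by (rule exI[of _ 0], rule bexI[of _ \<one>]) (simp_all add: generate.one)
  next
    case (incl h)
    show ?case
    proof (cases "h = s")
      case True
      then show ?thesis
        by (intro exI[of _ 1] bexI[of _ \<one>]) (simp_all add: generate.one)
    next
      case False
      then have "h \<in> generate G T"
        using incl by (simp add: generate.incl)
      then show ?thesis
        by (intro exI[of _ 0] bexI[of _ h]) simp_all
    qed
  next
    case (inv h)
    show ?case
    proof (cases "h = s")
      case True
      then show ?thesis
        by (intro exI[of _ "-1"] bexI[of _ \<one>]) (simp_all add: generate.one int_pow_neg)
    next
      case False
      then have "inv h \<in> generate G T"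
        using inv by (simp add: generate.inv)
      then show ?thesis
        by (intro exI[of _ 0] bexI[of _ "inv h"]) simp_all
    qed
  next
    case (eng x y)
    then obtain k l :: int and t u where
      t: "t \<in> generate G T" "x = s [^] k \<otimes> t" and u: "u \<in> generate G T" "y = s [^] l \<otimes> u"
      by blast
    then have "x \<otimes> y = s [^] (k + l) \<otimes> (t \<otimes> u)"
      by (simp add: int_pow_mult m_ac)
    with t u show ?case
      by (intro exI[of _ "k + l"] bexI[of _ "t \<otimes> u"]) (simp_all add: generate.eng)
  qed
  then show thesis
    using that by blast
qed

lemma (in comm_group) finite_generate_if_torsion:
  assumes "finite S" "S \<subseteq> carrier G" "\<And>s. s \<in> S \<Longrightarrow> \<exists>m :: int. m \<noteq> 0 \<and> s [^] m = \<one>"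
  shows "finite (generate G S)"
  using assms
proof (induction S)
  case empty
  then show ?case
    by (simp add: generate_empty)
next
  case (insert s T)
  then have s [simp]: "s \<in> carrier G" and T: "T \<subseteq> carrier G" and fin: "finite (generate G T)"
    by simp_all
  obtain m :: int where m: "m \<noteq> 0" "s [^] m = \<one>"
    using insert.prems(2) by blast
  have reduce: "s [^] k = s [^] (k mod \<bar>m\<bar>)" for k :: int
  proof -
    have "s [^] \<bar>m\<bar> = \<one>"
      using m(2) by (cases "m \<ge> 0") (simp_all add: int_pow_neg)
    then have "s [^] (\<bar>m\<bar> * (k div \<bar>m\<bar>)) = \<one>"
      using int_pow_pow[OF s, of "\<bar>m\<bar>" "k div \<bar>m\<bar>"] by simp
    then have "s [^] (\<bar>m\<bar> * (k div \<bar>m\<bar>) + k mod \<bar>m\<bar>) = s [^] (k mod \<bar>m\<bar>)"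
      by (simp only: int_pow_mult[OF s]) simp
    then show ?thesis
      by simp
  qed
  have "generate G (insert s T) \<subseteq> (\<lambda>(k, t). s [^] k \<otimes> t) ` ({0..<\<bar>m\<bar>} \<times> generate G T)"
  proof
    fix x assume "x \<in> generate G (insert s T)"
    then obtain k :: int and t where "t \<in> generate G T" "x = s [^] k \<otimes> t"
      using generate_insert_elements[OF s T] by blast
    moreover have "0 < \<bar>m\<bar>"
      using m(1) by auto
    then have "k mod \<bar>m\<bar> \<in> {0..<\<bar>m\<bar>}"
      by simp
    ultimately show "x \<in> (\<lambda>(k, t). s [^] k \<otimes> t) ` ({0..<\<bar>m\<bar>} \<times> generate G T)"
      using reduce[of k] by (intro image_eqI[of _ _ "(k mod \<bar>m\<bar>, t)"]) simp_all
  qed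
  then show ?case
    by (rule finite_subset) (use fin in simp)
qed

text \<open>
  If every generator is a square, the generators satisfy a linear system whose determinant is odd;
  eliminating one generator at a time avoids the determinant. Allowing an odd power of
  each generator to be a square of the span is what makes the induction go through: \<open>s\<^sup>m = u\<^sup>2\<close> with
  \<open>u = s\<^sup>k t\<close> becomes \<open>s\<^sup>n = t\<^sup>2\<close> for the odd number \<open>n = m - 2 k\<close>, and raising the other relations
  to the power \<open>n\<close> replaces \<open>s\<^sup>n\<close> in them by \<open>t\<^sup>2\<close>.
\<close>

lemma (in comm_group) odd_torsion_if_squares:
  assumes "finite S" "S \<subseteq> carrier G"
    and "\<And>s. s \<in> S \<Longrightarrow> \<exists>m :: int. odd m \<and> (\<exists>t\<in>generate G S. s [^] m = t \<otimes> t)"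
  shows "\<forall>s\<in>S. \<exists>m :: int. odd m \<and> s [^] m = \<one>"
  using assms
proof (induction S)
  case (insert s T)
  then have s [simp]: "s \<in> carrier G" and T: "T \<subseteq> carrier G"
    by simp_all
  note [simp] = generate_in_carrier[OF T]
  have split: "\<exists>k :: int. \<exists>t\<in>generate G T. u \<otimes> u = s [^] (2 * k) \<otimes> (t \<otimes> t)"
    if u: "u \<in> generate G (insert s T)" for u
  proof -
    obtain k :: int and t where t: "t \<in> generate G T" "u = s [^] k \<otimes> t"
      using generate_insert_elements[OF s T u] by blast
    then have "u \<otimes> u = (s [^] k \<otimes> s [^] k) \<otimes> (t \<otimes> t)"
      by (simp add: m_ac)
    then show ?thesis
      using t(1) by (metis int_pow_mult mult_2 s)
  qed
  obtain m :: int and u where m: "odd m" "u \<in> generate G (insert s T)" "s [^] m = u \<otimes> u"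
    using insert.prems(2)[of s] by blast
  obtain k :: int and t where t: "t \<in> generate G T" "s [^] m = s [^] (2 * k) \<otimes> (t \<otimes> t)"
    using split[OF m(2)] m(3) by auto
  define n where "n = m - 2 * k"
  have n: "odd n" "s [^] n = t \<otimes> t"
  proof -
    show "odd n"
      using m(1) by (simp add: n_def)
    have "s [^] n = inv (s [^] (2 * k)) \<otimes> s [^] m"
      by (simp add: n_def int_pow_diff m_comm)
    then show "s [^] n = t \<otimes> t"
      using t by (simp flip: m_assoc)
  qed
  have "\<forall>r\<in>T. \<exists>m :: int. odd m \<and> r [^] m = \<one>"
  proof (rule insert.IH[OF T])
    fix r assume r: "r \<in> T"
    then have r' [simp]: "r \<in> carrier G"
      using T by blast
    obtain p :: int and v where p: "odd p" "v \<in> generate G (insert s T)" "r [^] p = v \<otimes> v"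
      using insert.prems(2)[of r] r by blast
    obtain l :: int and w where w: "w \<in> generate G T" "r [^] p = s [^] (2 * l) \<otimes> (w \<otimes> w)"
      using split[OF p(2)] p(3) by auto
    have pow_T: "x [^] (i::int) \<in> generate G T" if "x \<in> generate G T" for x i
      using subgroup_int_pow_closed[OF generate_is_subgroup[OF T] that] .
    define z where "z = t [^] (2 * l) \<otimes> w [^] n"
    have z: "z \<in> generate G T"
      unfolding z_def using pow_T t(1) w(1) by (intro generate.eng)
    have "r [^] (p * n) = (s [^] (2 * l) \<otimes> (w \<otimes> w)) [^] n"
      using int_pow_pow[OF r', of p n] w(2) by simp
    also have "\<dots> = (s [^] n) [^] (2 * l) \<otimes> (w [^] n \<otimes> w [^] n)"
      using w(1) by (simp add: int_pow_distrib int_pow_pow mult.commute)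
    also have "\<dots> = (t [^] (2 * l) \<otimes> t [^] (2 * l)) \<otimes> (w [^] n \<otimes> w [^] n)"
      using t(1) n(2) by (simp add: int_pow_distrib)
    also have "\<dots> = z \<otimes> z"
      using t(1) w(1) by (simp add: z_def m_ac)
    finally show "\<exists>m :: int. odd m \<and> (\<exists>t\<in>generate G T. r [^] m = t \<otimes> t)"
      using p(1) n(1) z by (intro exI[of _ "p * n"]) auto
  qed
  moreover have "\<exists>m :: int. odd m \<and> s [^] m = \<one>"
  proof -
    have "\<exists>i :: int. odd i \<and> x [^] i = \<one>" if "x \<in> generate G T" for x
      using that
    proof induction
      case one
      show ?case
        by (rule exI[of _ 1]) simp
    next
      case (incl h)
      then show ?case
        using calculation by blast
    next
      case (inv h)
      then obtain i :: int where "odd i" "h [^] i = \<one>" "h \<in> carrier G"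
        using calculation T by blast
      then show ?case
        by (intro exI[of _ i]) (simp add: int_pow_inv)
    next
      case (eng x y)
      then obtain i j :: int where ij: "odd i" "x [^] i = \<one>" "odd j" "y [^] j = \<one>"
        by blast
      have "(x \<otimes> y) [^] (i * j) = (x [^] i) [^] j \<otimes> (y [^] j) [^] i"
        using eng.hyps by (simp add: int_pow_distrib int_pow_pow mult.commute)
      then show ?case
        using ij by (intro exI[of _ "i * j"]) simp
    qed
    then obtain i :: int where i: "odd i" "t [^] i = \<one>"
      using t(1) by blast
    have "s [^] (n * i) = t [^] i \<otimes> t [^] i"
      using int_pow_pow[OF s, of n i] n(2) t(1) by (simp add: int_pow_distrib)
    then show ?thesis
      using i n(1) by (intro exI[of _ "n * i"]) simp
  qed
  ultimately show ?case
    by blast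
qed simp

text \<open>
  Adjoining the generators to \<open>B\<close> one by one, some step leads from a proper subgroup to the whole
  group. As all squares lie in \<open>B\<close>, the subgroup before that step has index 2.
\<close>

lemma (in comm_group) exists_index_two_subgroup:
  assumes "finite S" "S \<subseteq> carrier G" and B: "B \<subseteq> carrier G" "generate G B \<noteq> carrier G"
    and squares: "\<And>x. x \<in> carrier G \<Longrightarrow> x \<otimes> x \<in> B" and "generate G (S \<union> B) = carrier G"
  shows "\<exists>A. subgroup A G \<and> A \<noteq> carrier G \<and>
    (\<forall>g\<in>carrier G - A. \<forall>h\<in>carrier G - A. g \<otimes> h \<in> A)"
  using assms(1,2,6)
proof (induction S)
  case empty
  then show ?case
    using B by simp
next
  case (insert s T)
  show ?case
  proof (cases "generate G (T \<union> B) = carrier G")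
    case False
    let ?A = "generate G (T \<union> B)"
    have s [simp]: "s \<in> carrier G" and T: "T \<union> B \<subseteq> carrier G"
      using insert.prems B by auto
    have A: "subgroup ?A G"
      by (rule generate_is_subgroup[OF T])
    have sq: "x \<otimes> x \<in> ?A" if "x \<in> carrier G" for x
      using squares[OF that] by (simp add: generate.incl)
    have mem: "\<exists>a\<in>?A. g = s \<otimes> a" if g: "g \<in> carrier G" "g \<notin> ?A" for g
    proof -
      have "g \<in> generate G (insert s (T \<union> B))"
        using insert.prems(2) g(1) by simp
      then obtain k :: int and a where a: "a \<in> ?A" "g = s [^] k \<otimes> a"
        using generate_insert_elements[OF s T] by blast
      note [simp] = generate_in_carrier[OF T a(1)]
      define j where "j = k div 2"
      have even_part: "s [^] (2 * j) \<in> ?A"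
        using sq[of "s [^] j"] int_pow_mult[OF s, of j j] by simp
      show ?thesis
      proof (cases "even k")
        case True
        then have "k = 2 * j"
          by (simp add: j_def)
        then have "g \<in> ?A"
          using a even_part by (simp add: generate.eng)
        then show ?thesis
          using g(2) by simp
      next
        case False
        then have "k = 1 + 2 * j"
          unfolding j_def by presburger
        then have "g = s \<otimes> (s [^] (2 * j) \<otimes> a)"
          using a(2) by (simp add: int_pow_mult m_assoc)
        then show ?thesis
          by (rule bexI[OF _ generate.eng[OF even_part a(1)]])
      qed
    qed
    have "g \<otimes> h \<in> ?A" if "g \<in> carrier G - ?A" "h \<in> carrier G - ?A" for g h
    proof -
      from mem[of g] mem[of h] that obtain a b
        where a: "a \<in> ?A" "g = s \<otimes> a" and b: "b \<in> ?A" "h = s \<otimes> b"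
        by auto
      have [simp]: "a \<in> carrier G" "b \<in> carrier G"
        using generate_in_carrier[OF T a(1)] generate_in_carrier[OF T b(1)] by simp_all
      have "g \<otimes> h = (s \<otimes> s) \<otimes> (a \<otimes> b)"
        unfolding a(2) b(2) by (simp add: m_ac)
      then show ?thesis
        using generate.eng[OF sq[OF s] generate.eng[OF a(1) b(1)]] by simp
    qed
    then have "\<forall>g\<in>carrier G - ?A. \<forall>h\<in>carrier G - ?A. g \<otimes> h \<in> ?A"
      by simp
    with A False show ?thesis
      by (intro exI[of _ ?A] conjI)
  qed (use insert in simp)
qed

lemma (in group) exists_involution_if_even_order:
  assumes "finite (carrier G)" "even (order G)"
  shows "\<exists>t\<in>carrier G. t \<noteq> \<one> \<and> t \<otimes> t = \<one>"
proof -
  obtain m where "order G = 2 ^ 1 * m"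
    using assms(2) by auto
  then obtain K where K: "subgroup K G" "card K = 2"
    using sylow_thm[OF two_is_prime_nat group_axioms _ assms(1), of 1 m] by auto
  interpret K: subgroup K G by fact
  obtain a b where "K = {a, b}" "a \<noteq> b"
    using K(2) by (auto simp: card_2_iff)
  then have "K = {\<one>, b} \<and> b \<noteq> \<one> \<or> K = {\<one>, a} \<and> a \<noteq> \<one>"
    using K.one_closed by auto
  then have "\<exists>t. t \<noteq> \<one> \<and> K = {\<one>, t}"
    by blast
  then obtain t where t: "t \<noteq> \<one>" "K = {\<one>, t}"
    by blast
  then have "t \<otimes> t \<in> {\<one>, t}" "t \<in> carrier G"
    using K.m_closed[of t t] K.mem_carrier[of t] by auto
  then show ?thesis
    using t(1) by auto
qed

text \<open>
  Without a subgroup of index 2, every element is a square, so the generators have odd order and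
  the group is finite. Squaring, being onto, is then injective, which rules out involutions.
\<close>

theorem (in comm_group) finite_odd_if_no_index_two:
  assumes S: "finite S" "S \<subseteq> carrier G" "generate G S = carrier G"
    and no_index_two: "\<not> (\<exists>A. subgroup A G \<and> A \<noteq> carrier G \<and>
      (\<forall>g\<in>carrier G - A. \<forall>h\<in>carrier G - A. g \<otimes> h \<in> A))"
  shows "finite (carrier G) \<and> odd (order G)"
proof -
  let ?B = "(\<lambda>x. x \<otimes> x) ` carrier G"
  have B: "subgroup ?B G"
  proof (rule subgroupI)
    fix a assume "a \<in> ?B"
    then obtain x where "x \<in> carrier G" "a = x \<otimes> x"
      by blast
    then show "inv a \<in> ?B"
      by (intro image_eqI[of _ _ "inv x"]) (simp_all add: inv_mult)
  next
    fix a b assume "a \<in> ?B" "b \<in> ?B"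
    then obtain x y where "x \<in> carrier G" "a = x \<otimes> x" "y \<in> carrier G" "b = y \<otimes> y"
      by blast
    then show "a \<otimes> b \<in> ?B"
      by (intro image_eqI[of _ _ "x \<otimes> y"]) (simp_all add: m_ac)
  qed auto
  have "generate G (S \<union> ?B) = carrier G"
    using mono_generate[of S "S \<union> ?B"] generate_incl[of "S \<union> ?B"] S(2,3) by auto
  then have "generate G ?B = carrier G"
    using exists_index_two_subgroup[OF S(1,2), of ?B] no_index_two by auto
  then have onto: "?B = carrier G"
    using generate_minimal[OF subgroup.subset[OF B]] generate_subgroup_incl[OF _ B, of ?B] generate.incl
    by blast
  have torsion: "\<forall>s\<in>S. \<exists>m :: int. odd m \<and> s [^] m = \<one>"
  proof (rule odd_torsion_if_squares[OF S(1,2)])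
    fix s assume "s \<in> S"
    then have "s \<in> carrier G"
      using S(2) by blast
    moreover from this obtain x where "x \<in> carrier G" "s = x \<otimes> x"
      using onto by blast
    ultimately show "\<exists>m :: int. odd m \<and> (\<exists>t\<in>generate G S. s [^] m = t \<otimes> t)"
      using S(3) by (intro exI[of _ 1]) auto
  qed
  have "\<exists>m :: int. m \<noteq> 0 \<and> s [^] m = \<one>" if "s \<in> S" for s
    using torsion that by (metis even_zero)
  then have fin: "finite (carrier G)"
    using finite_generate_if_torsion[OF S(1,2)] S(3) by simp
  have inj: "inj_on (\<lambda>x. x \<otimes> x) (carrier G)"
    using onto fin by (simp add: eq_card_imp_inj_on)
  have "odd (order G)"
  proof
    assume "even (order G)"
    then obtain t where "t \<in> carrier G" "t \<noteq> \<one>" "t \<otimes> t = \<one>"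
      using exists_involution_if_even_order[OF fin] by blast
    then show False
      using inj_onD[OF inj, of t \<one>] by simp
  qed
  with fin show ?thesis ..
qed

text \<open>
  Building up the generating set, a generator that already lies in the span changes nothing, and
  any other one contributes a new independent coordinate.
\<close>

lemma (in comm_group) exponent_two_iso_power:
  assumes exp: "\<And>x. x \<in> carrier G \<Longrightarrow> x \<otimes> x = \<one>" and "finite S" "S \<subseteq> carrier G"
  shows "\<exists>r \<phi>. \<phi> \<in> hom (product_group {..<r::nat} (\<lambda>_. integer_mod_group 2)) G \<and>
    bij_betw \<phi> (carrier (product_group {..<r} (\<lambda>_. integer_mod_group 2))) (generate G S)"
  using assms(2,3)
proof (induction S)
  case empty
  show ?case
    by (rule exI[of _ 0], rule exI[of _ "\<lambda>_. \<one>"]) (auto simp: hom_def bij_betw_def generate_empty)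
next
  case (insert s T)
  let ?P = "\<lambda>r. product_group {..<r::nat} (\<lambda>_. integer_mod_group 2)"
  have s [simp]: "s \<in> carrier G" and T: "T \<subseteq> carrier G"
    using insert.prems by auto
  note T_closed = generate_in_carrier[OF T]
  obtain r \<phi> where hom: "\<phi> \<in> hom (?P r) G" and bij: "bij_betw \<phi> (carrier (?P r)) (generate G T)"
    using insert by auto
  have \<phi>_closed: "\<phi> f \<in> carrier G" if "f \<in> carrier (?P r)" for f
    using hom_in_carrier[OF hom that] .
  have s2: "s \<otimes> s = \<one>"
    using exp by simp
  have parity: "s [^] k = (if even k then \<one> else s)" for k :: int
  proof -
    have even_pow: "s [^] (2 * j) = \<one>" for j :: int
      using exp[of "s [^] j"] int_pow_mult[OF s, of j j] by simp
    show ?thesis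
    proof (cases "even k")
      case True
      then show ?thesis
        using even_pow[of "k div 2"] by simp
    next
      case False
      then have "k = 2 * (k div 2) + 1"
        by presburger
      then have "s [^] k = s [^] (2 * (k div 2)) \<otimes> s"
        using int_pow_mult[OF s, of "2 * (k div 2)" 1] by simp
      then show ?thesis
        using False even_pow by simp
    qed
  qed
  show ?case
  proof (cases "s \<in> generate G T")
    case True
    have "generate G (insert s T) = generate G T"
    proof
      show "generate G (insert s T) \<subseteq> generate G T"
        by (rule generate_subgroup_incl[OF _ generate_is_subgroup[OF T]])
          (use True generate.incl in auto)
    qed (rule mono_generate, blast)
    with hom bij show ?thesis
      by auto
  next
    case False
    define \<psi> where "\<psi> f = s [^] f r \<otimes> \<phi> (restrict f {..<r})" for f :: "nat \<Rightarrow> int"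
    have restr: "restrict f {..<r} \<in> carrier (?P r)" if "f \<in> carrier (?P (Suc r))" for f
      using that by (auto simp: PiE_iff lessThan_Suc)
    have last: "f r = 0 \<or> f r = 1" if "f \<in> carrier (?P (Suc r))" for f
      using that by (auto simp: PiE_iff lessThan_Suc carrier_integer_mod_group)
    have "\<psi> \<in> hom (?P (Suc r)) G"
    proof (rule homI)
      show "\<psi> f \<in> carrier G" if "f \<in> carrier (?P (Suc r))" for f
        using \<phi>_closed[OF restr[OF that]] by (simp add: \<psi>_def)
      fix f g assume f: "f \<in> carrier (?P (Suc r))" and g: "g \<in> carrier (?P (Suc r))"
      have "restrict (f \<otimes>\<^bsub>?P (Suc r)\<^esub> g) {..<r} = restrict f {..<r} \<otimes>\<^bsub>?P r\<^esub> restrict g {..<r}"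
        by (auto simp: fun_eq_iff)
      then have 1: "\<phi> (restrict (f \<otimes>\<^bsub>?P (Suc r)\<^esub> g) {..<r}) = \<phi> (restrict f {..<r}) \<otimes> \<phi> (restrict g {..<r})"
        using hom_mult[OF hom restr[OF f] restr[OF g]] by simp
      have 2: "s [^] (f \<otimes>\<^bsub>?P (Suc r)\<^esub> g) r = s [^] f r \<otimes> s [^] g r"
        using last[OF f] last[OF g] s2 by (auto simp: parity)
      show "\<psi> (f \<otimes>\<^bsub>?P (Suc r)\<^esub> g) = \<psi> f \<otimes> \<psi> g"
        unfolding \<psi>_def 1 2
        using \<phi>_closed[OF restr[OF f]] \<phi>_closed[OF restr[OF g]] by (simp add: m_ac)
    qed
    moreover have "bij_betw \<psi> (carrier (?P (Suc r))) (generate G (insert s T))"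
      unfolding bij_betw_def
    proof
      show "inj_on \<psi> (carrier (?P (Suc r)))"
      proof (rule inj_onI)
        fix f g assume f: "f \<in> carrier (?P (Suc r))" and g: "g \<in> carrier (?P (Suc r))" and eq: "\<psi> f = \<psi> g"
        let ?a = "\<phi> (restrict f {..<r})" and ?b = "\<phi> (restrict g {..<r})"
        have ab: "?a \<in> generate G T" "?b \<in> generate G T"
          using bij_betwE[OF bij] restr f g by blast+
        note ab' = ab[THEN T_closed]
        have mem: "s \<in> generate G T" if "s \<otimes> c = d" "c \<in> generate G T" "d \<in> generate G T" for c d
          using mult_mem_subgroup_right_iff[OF generate_is_subgroup[OF T] that(2) s] that by simp
        have same: "f r = g r"
          using last[OF f] last[OF g] eq mem[of ?a ?b] mem[of ?b ?a] ab ab' False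
          by (auto simp: \<psi>_def parity)
        then have "?a = ?b"
          using eq ab' by (simp add: \<psi>_def)
        then have restr_eq: "restrict f {..<r} = restrict g {..<r}"
          by (rule inj_onD[OF bij_betw_imp_inj_on[OF bij] _ restr[OF f] restr[OF g]])
        show "f = g"
        proof (rule PiE_ext)
          show "f \<in> PiE {..<Suc r} (\<lambda>_. carrier (integer_mod_group 2))"
            "g \<in> PiE {..<Suc r} (\<lambda>_. carrier (integer_mod_group 2))"
            using f g by simp_all
          fix i assume "i \<in> {..<Suc r}"
          then show "f i = g i"
            using same fun_cong[OF restr_eq, of i] by (cases "i = r") auto
        qed
      qed
      show "\<psi> ` carrier (?P (Suc r)) = generate G (insert s T)"
      proof
        show "\<psi> ` carrier (?P (Suc r)) \<subseteq> generate G (insert s T)"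
        proof (rule image_subsetI)
          fix f assume f: "f \<in> carrier (?P (Suc r))"
          have "\<phi> (restrict f {..<r}) \<in> generate G (insert s T)"
            using bij_betwE[OF bij] restr[OF f] mono_generate[of T "insert s T"] by blast
          moreover have "s [^] f r \<in> generate G (insert s T)"
            by (simp add: parity generate.one generate.incl)
          ultimately show "\<psi> f \<in> generate G (insert s T)"
            unfolding \<psi>_def by (intro generate.eng)
        qed
        show "generate G (insert s T) \<subseteq> \<psi> ` carrier (?P (Suc r))"
        proof
          fix x assume "x \<in> generate G (insert s T)"
          then obtain k :: int and t where t: "t \<in> generate G T" "x = s [^] k \<otimes> t"
            using generate_insert_elements[OF s T] by blast
          obtain f where f: "f \<in> carrier (?P r)" "\<phi> f = t"
            using t(1) by (auto simp flip: bij_betw_imp_surj_on[OF bij])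
          let ?f = "f(r := k mod 2)"
          have "?f \<in> carrier (?P (Suc r))"
            using f(1) by (auto simp: PiE_iff lessThan_Suc carrier_integer_mod_group extensional_def)
          moreover have "restrict ?f {..<r} = f"
            using f(1) by (auto simp: fun_eq_iff PiE_iff extensional_def)
          then have "\<psi> ?f = x"
            using f(2) t(2) by (simp add: \<psi>_def parity)
          ultimately show "x \<in> \<psi> ` carrier (?P (Suc r))"
            by blast
        qed
      qed
    qed
    ultimately show ?thesis
      by blast
  qed
qed

lemma (in group) exponent_two_if_iso_power:
  assumes "G \<cong> product_group {..<r::nat} (\<lambda>_. integer_mod_group 2)" and x: "x \<in> carrier G"
  shows "x \<otimes> x = \<one>"
proof -
  let ?P = "product_group {..<r::nat} (\<lambda>_. integer_mod_group 2)"
  obtain \<phi> where \<phi>: "\<phi> \<in> hom G ?P" "inj_on \<phi> (carrier G)"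
    using assms(1) by (auto simp: is_iso_def iso_def bij_betw_def)
  have P: "group ?P"
    by simp
  have "(n + n) mod 2 = 0" for n :: int
    by presburger
  then have "\<phi> x \<otimes>\<^bsub>?P\<^esub> \<phi> x = \<one>\<^bsub>?P\<^esub>"
    by simp
  then have "\<phi> (x \<otimes> x) = \<phi> \<one>"
    using hom_mult[OF \<phi>(1) x x] hom_one[OF \<phi>(1) group_axioms P] by simp
  then show ?thesis
    using inj_onD[OF \<phi>(2)] x by simp
qed

theorem theorem7:
  fixes G :: "('a, 'b) monoid_scheme"
  assumes "group G" and "finitely_generated_group G"
  shows "(\<not> comm_group G \<longrightarrow> (natural_group G \<longleftrightarrow> \<not> generalized_dicyclic G)) \<and>
         (comm_group G \<longrightarrow>
            (natural_group G \<longleftrightarrow>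
               finite (carrier G) \<and> odd (order G) \<or>
               (\<exists>r::nat. G \<cong> product_group {..<r} (\<lambda>_. integer_mod_group 2))))"
proof -
  interpret group G by fact
  obtain S where S: "finite S" "S \<subseteq> carrier G" "generate G S = carrier G"
    using assms(2) by (auto simp: finitely_generated_group_def)
  have countable: "countable (carrier G)"
    using countable_generate[OF countable_finite[OF S(1)] S(2)] S(3) by simp
  have "natural_group G \<longleftrightarrow> finite (carrier G) \<and> odd (order G) \<or>
      (\<exists>r::nat. G \<cong> product_group {..<r} (\<lambda>_. integer_mod_group 2))"
    if "comm_group G"
  proof -
    interpret comm_group G by fact
    show ?thesis
    proof
      assume nat: "natural_group G"
      show "finite (carrier G) \<and> odd (order G) \<or>
        (\<exists>r::nat. G \<cong> product_group {..<r} (\<lambda>_. integer_mod_group 2))"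
      proof (cases "\<exists>A. subgroup A G \<and> A \<noteq> carrier G \<and>
          (\<forall>g\<in>carrier G - A. \<forall>h\<in>carrier G - A. g \<otimes>\<^bsub>G\<^esub> h \<in> A)")
        case True
        then obtain A where A: "subgroup A G" "A \<noteq> carrier G"
            "\<forall>g\<in>carrier G - A. \<forall>h\<in>carrier G - A. g \<otimes>\<^bsub>G\<^esub> h \<in> A"
          by blast
        then obtain w where "w \<in> carrier G" "w \<notin> A"
          using subgroup.subset[OF A(1)] by blast
        then have "x \<otimes>\<^bsub>G\<^esub> x = \<one>\<^bsub>G\<^esub>" if "x \<in> carrier G" for x
          using exponent_two_if_natural[OF nat A(1)] A(3) that by simp
        then obtain r \<phi> where
          "\<phi> \<in> hom (product_group {..<r::nat} (\<lambda>_. integer_mod_group 2)) G"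
          "bij_betw \<phi> (carrier (product_group {..<r} (\<lambda>_. integer_mod_group 2))) (carrier G)"
          using exponent_two_iso_power[OF _ S(1,2)] S(3) by auto
        then have "product_group {..<r} (\<lambda>_. integer_mod_group 2) \<cong> G"
          by (intro is_isoI) (simp add: iso_def)
        moreover have "group (product_group {..<r} (\<lambda>_. integer_mod_group 2))"
          by simp
        ultimately show ?thesis
          using group.iso_sym by blast
      qed (use finite_odd_if_no_index_two[OF S] in blast)
    next
      assume "finite (carrier G) \<and> odd (order G) \<or>
        (\<exists>r::nat. G \<cong> product_group {..<r} (\<lambda>_. integer_mod_group 2))"
      then have "finite (carrier G) \<and> odd (order G) \<or> (\<forall>x\<in>carrier G. x \<otimes>\<^bsub>G\<^esub> x = \<one>\<^bsub>G\<^esub>)"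
        using exponent_two_if_iso_power by blast
      then show "natural_group G"
        by (rule natural_if_abelian[OF countable])
    qed
  qed
  then show ?thesis
    using natural_if_nonabelian[OF countable] not_natural_if_generalized_dicyclic by blast
qed

end
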